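(* Under the von Mises community model with parameters $(n,k,\kappa)$, as $n\to\infty$, each of the following conditions implies the impossibility of weak detection, where $R(\kappa)=I_0(2\kappa)/I_0^2(\kappa)$. (These conditions require $\kappa$ to be smaller for larger $k$, and in particular $\kappa\to0$ for $k=\omega(\log n)$.) (i) $k=o(\log n)$ and $\kappa\le\left(n/k^2\right)^{\frac{4-\epsilon}{k-1}}$ for some $\epsilon>0$. (ii) $k=c\log n$ for some $c>0$ and $c\log R(\kappa)<2$. (iii) $k=\omega(\log n)$ and $k\le n^c$ for some $c$ with $0<c<0.5$, and $\kappa^2\le\frac{4(1-2c-\epsilon)\log n}{k-1}$ for some $\epsilon>0$.
   Context: $I_0(\kappa)=\frac1{2\pi}\int_0^{2\pi}e^{\kappa\cos u}\,du$ is the modified Bessel function of the first kind of order $0$. $\mathrm{vonMises}(\Theta,\kappa)$ ($\kappa>0$) is the distribution on $[0,2\pi)$ with density $\frac{1}{2\pi I_0(\kappa)}\exp(\kappa\cos(\theta-\Theta))$. Von Mises community model $(n,k,\kappa)$, with $k$ and $\kappa>0$ possibly depending on $n$: a symmetric array of angles $X=(X_{ij})_{1\le i<j\le n}$, $X_{ij}=X_{ji}\in[0,2\pi)$, is observed, viewed as labels $X_e$ on the edges $e=\{i,j\}$ of the complete graph on $[n]=\{1,\dots,n\}$. For $C\subset[n]$, $E(C)$ is the set of edges with both endpoints in $C$. Under $H_0$ (law $\mathbb{Q}$) the $X_{ij}$, $i<j$, are i.i.d. uniform on $[0,2\pi)$. Under $H_1$ (law $\mathbb{P}$), a community $C^*\subset[n]$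 is drawn uniformly at random among subsets of size $k$, a phase $\Theta^*$ is drawn independently and uniformly on $[0,2\pi)$, and given $(C^*,\Theta^* )$ the labels are independent with $X_e\sim\mathrm{vonMises}(\Theta^*,\kappa)$ for $e\in E(C^* )$ and $X_e$ uniform on $[0,2\pi)$ for all other edges. $\mathbb{P}$ is the resulting mixture law of $X$. $k=\omega(\log n)$ means $k/\log n\to\infty$ and $k=o(\log n)$ means $k/\log n\to0$; $\log$ is the natural logarithm. A test is a measurable function $\phi$ of the data with values in $\{0,1\}$ ($1$ means reject $H_0$). $p_{\mathrm{fa}}(\phi)=\mathbb{Q}\{\phi(X)=1\}$ and $p_{\mathrm{miss}}(\phi)=\mathbb{P}\{\phi(X)=0\}$. Weak detection is impossible if every sequence of tests satisfies $p_{\mathrm{fa}}+p_{\mathrm{miss}}\ge 1-o(1)$; equivalently the total variation distance between $\mathbb{P}$ and $\mathbb{Q}$ tends to $0$. *)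

theory Defs
  imports "HOL-Probability.Probability"
begin

definition bessel_I0 :: "real \<Rightarrow> real" where
  "bessel_I0 \<kappa> = 1 / (2 * pi) * integral {0..2 * pi} (\<lambda>u. exp (\<kappa> * cos u))"

definition bessel_ratio :: "real \<Rightarrow> real" where
  "bessel_ratio \<kappa> = bessel_I0 (2 * \<kappa>) / (bessel_I0 \<kappa>)\<^sup>2"

definition angles :: "real measure" where
  "angles = restrict_space lborel {0..<2 * pi}"

definition uniform_angle :: "real measure" where
  "uniform_angle = uniform_measure angles {0..<2 * pi}"

definition von_mises :: "real \<Rightarrow> real \<Rightarrow> real measure" where
  "von_mises \<Theta> \<kappa> =
     density angles (\<lambda>\<theta>. ennreal (1 / (2 * pi * bessel_I0 \<kappa>) * exp (\<kappa> * cos (\<theta> - \<Theta>))))"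

(* An edge is a two-element set {i, j}, so the symmetry X_ij = X_ji of the array of
   labels is built into the index set of the product measures below. *)
definition edges :: "nat set \<Rightarrow> nat set set" where
  "edges C = {e. e \<subseteq> C \<and> card e = 2}"

definition null_law :: "nat \<Rightarrow> (nat set \<Rightarrow> real) measure" where
  "null_law n = (\<Pi>\<^sub>M e\<in>edges {1..n}. uniform_angle)"

definition community_law ::
    "nat \<Rightarrow> real \<Rightarrow> nat set \<Rightarrow> real \<Rightarrow> (nat set \<Rightarrow> real) measure" where
  "community_law n \<kappa> C \<Theta> =
     (\<Pi>\<^sub>M e\<in>edges {1..n}. if e \<in> edges C then von_mises \<Theta> \<kappa> else uniform_angle)"

(* The mixture over an independent pair (C, \<Theta>); meaningful for k \<le> n, as pmf_of_set needs
   a nonempty set. *)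
definition planted_law :: "nat \<Rightarrow> nat \<Rightarrow> real \<Rightarrow> (nat set \<Rightarrow> real) measure" where
  "planted_law n k \<kappa> =
     measure_pmf (pmf_of_set {C. C \<subseteq> {1..n} \<and> card C = k}) \<bind>
       (\<lambda>C. uniform_angle \<bind> (\<lambda>\<Theta>. community_law n \<kappa> C \<Theta>))"

definition p_fa :: "'a measure \<Rightarrow> ('a \<Rightarrow> nat) \<Rightarrow> real" where
  "p_fa Q \<phi> = measure Q {x \<in> space Q. \<phi> x = 1}"

definition p_miss :: "'a measure \<Rightarrow> ('a \<Rightarrow> nat) \<Rightarrow> real" where
  "p_miss P \<phi> = measure P {x \<in> space P. \<phi> x = 0}"

(* Q n is the law under the null hypothesis, P n the law under the alternative. *)
definition weak_detection_impossible ::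
    "(nat \<Rightarrow> 'a measure) \<Rightarrow> (nat \<Rightarrow> 'a measure) \<Rightarrow> bool" where
  "weak_detection_impossible Q P \<longleftrightarrow>
     (\<forall>\<phi>. (\<forall>n. \<phi> n \<in> Q n \<rightarrow>\<^sub>M count_space {0, 1}) \<longrightarrow>
        (\<exists>r. r \<longlonglongrightarrow> 0 \<and> (\<forall>n. p_fa (Q n) (\<phi> n) + p_miss (P n) (\<phi> n) \<ge> 1 - r n)))"

end

theory Submission
  imports Defs "HOL-Real_Asymp.Real_Asymp"
begin

text \<open>
  The proof is a truncated second moment argument. Given the community \<open>C\<close> and the phase
  \<open>\<Theta>\<close>, the planted law has density \<open>L = likelihood \<kappa> C \<Theta>\<close> with respect to the null law, a product
  of von Mises density ratios over the edges inside \<open>C\<close>. Replace \<open>L\<close> by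
  \<open>g = L * 1{L \<le> T}\<close> and average over \<open>(C, \<Theta>)\<close> to get \<open>G\<close>. Discarding mass only lowers the
  planted probability of accepting, so \<open>1 - p_fa - p_miss\<close> is at most the null expectation of
  \<open>|1 - G|\<close>, and Cauchy--Schwarz bounds this by the square root of
  \<open>(E[G^2] - 1) + 2 * (1 - E[G])\<close> (\<open>truncated_second_moment\<close>, \<open>testing_bound\<close>).

  For two independent copies of \<open>(C, \<Theta>)\<close> whose communities share \<open>m\<close> vertices, only the
  \<open>m choose 2\<close> common edges correlate the two densities. Each of them contributes a factor of at most
  \<open>R = bessel_ratio \<kappa>\<close>, whatever the phases are (\<open>nn_integral_vm_ratio_mult\<close>), and truncation
  caps the product by \<open>T\<close>. Since the overlap equals \<open>m\<close> with probability at most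
  \<open>(k^2 / n) ^ m\<close> (\<open>average_overlap_le\<close>), \<open>E[G^2] - 1\<close> is at most the sum over
  \<open>2 \<le> m \<le> k\<close> of \<open>(k^2 / n) ^ m * min (R ^ (m choose 2)) T\<close>. Everything reduces to bounding each
  summand by \<open>q ^ m\<close> with \<open>q\<close> tending to 0 (\<open>impossible_from_moments\<close>).

  For \<open>k = o(log n)\<close> and \<open>k = \<omega>(log n)\<close> the threshold \<open>T\<close> can be taken so large that
  truncation has only a negligible effect. There it suffices to know that \<open>R\<close> grows at most like \<open>sqrt \<kappa>\<close>
  (\<open>bessel_ratio_upper\<close>) and that \<open>ln R\<close> is at most \<open>(1 / 2 + o(1)) * \<kappa>^2\<close> near 0
  (\<open>ln_bessel_ratio_near_0\<close>).

  For \<open>k \<sim> c log n\<close> the hypothesis \<open>c * ln R < 2\<close> allows \<open>c * ln R\<close> to tend to 2, and then the plain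
  second moment may blow up through overlaps \<open>m\<close> close to \<open>k\<close>. The values of \<open>\<kappa>\<close> for which this
  is an issue stay in a compact interval away from 0, where the typical size of \<open>ln L\<close> per edge is smaller than \<open>ln R\<close> by a fixed
  margin. The margin comes from the strict Cauchy--Schwarz inequality
  \<open>I0(3\<kappa>/2)^2 < I0(\<kappa>) * I0(2\<kappa>)\<close> (\<open>bessel_I0_strict_log_convex\<close>). It leaves room for a
  threshold \<open>T\<close> of smaller exponential order than \<open>R ^ (k choose 2)\<close> that still cuts off only
  a vanishing part of the mass (\<open>tail_mass_le\<close>).
\<close>

section \<open>Bessel function estimates\<close>

lemma integral_periodic_shift:
  fixes f :: "real \<Rightarrow> real"
  assumes cont: "continuous_on UNIV f" and per: "\<And>x. f (x + p) = f x" and t: "0 \<le> t" "t \<le> p"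
  shows "integral {0..p} (\<lambda>x. f (x - t)) = integral {0..p} f"
proof -
  have int: "f integrable_on {a..b}" for a b
    by (rule integrable_continuous_real, rule continuous_on_subset[OF cont]) auto
  have "integral {0..p} (\<lambda>x. f (x - t)) = integral {-t..p - t} f"
    using integral_shift_Icc_real[of 0 p f "-t"] by (simp add: o_def)
  also have "\<dots> = integral {-t..0} f + integral {0..p - t} f"
    by (rule Henstock_Kurzweil_Integration.integral_combine[symmetric]) (use t int in auto)
  also have "integral {-t..0} f = integral {p - t..p} f"
  proof -
    have "f \<circ> (+) p = f" by (auto simp: fun_eq_iff per add.commute)
    then show ?thesis using integral_shift_Icc_real[of "-t" 0 f p] by simp
  qed
  also have "integral {p - t..p} f + integral {0..p - t} f = integral {0..p} f"
    using Henstock_Kurzweil_Integration.integral_combine[of 0 "p - t" p f] t int by simp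
  finally show ?thesis .
qed

lemma bessel_I0_shift:
  assumes "0 \<le> \<Theta>" "\<Theta> \<le> 2 * pi"
  shows "bessel_I0 \<kappa> = 1 / (2 * pi) * integral {0..2 * pi} (\<lambda>u. exp (\<kappa> * cos (u - \<Theta>)))"
  unfolding bessel_I0_def
  by (subst integral_periodic_shift[where f = "\<lambda>u. exp (\<kappa> * cos u)", symmetric])
     (use assms in \<open>auto intro!: continuous_intros\<close>)

lemma bessel_I0_mono:
  assumes "\<And>u. 0 \<le> u \<Longrightarrow> u \<le> 2 * pi \<Longrightarrow> exp (\<kappa> * cos u) \<le> f u"
    and "f integrable_on {0..2 * pi}"
  shows "bessel_I0 \<kappa> \<le> 1 / (2 * pi) * integral {0..2 * pi} f"
  unfolding bessel_I0_def
  using assms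
  by (intro mult_left_mono integral_le)
     (auto intro!: integrable_continuous_real continuous_intros)

lemma bessel_I0_ge:
  assumes "\<And>u. 0 \<le> u \<Longrightarrow> u \<le> 2 * pi \<Longrightarrow> f u \<le> exp (\<kappa> * cos u)"
    and "f integrable_on {0..2 * pi}"
  shows "1 / (2 * pi) * integral {0..2 * pi} f \<le> bessel_I0 \<kappa>"
  unfolding bessel_I0_def
  using assms
  by (intro mult_left_mono integral_le)
     (auto intro!: integrable_continuous_real continuous_intros)

text \<open>The averages of \<open>cos\<close> and \<open>cos^2\<close> over a period, which are all that Taylor bounds for
  \<open>I0\<close> near 0 require.\<close>
lemma has_integral_cos_poly:
  "((\<lambda>u. a + b * cos u + c * (cos u)\<^sup>2) has_integral 2 * pi * (a + c / 2)) {0..2 * pi}"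
proof -
  have "((\<lambda>u. a + b * cos u + c * (cos u)\<^sup>2) has_integral
      (\<lambda>u. a * u + b * sin u + c * (u / 2 + sin u * cos u / 2)) (2 * pi)
      - (\<lambda>u. a * u + b * sin u + c * (u / 2 + sin u * cos u / 2)) 0) {0..2 * pi}"
  proof (rule fundamental_theorem_of_calculus)
    fix x :: real
    have "(cos x)\<^sup>2 = 1 / 2 + (cos x * cos x - sin x * sin x) / 2"
      using sin_cos_squared_add[of x] by (simp add: power2_eq_square field_simps)
    then have "c * (cos x)\<^sup>2 = c * (1 / 2 + (cos x * cos x - sin x * sin x) / 2)" by simp
    then show "((\<lambda>u. a * u + b * sin u + c * (u / 2 + sin u * cos u / 2)) has_vector_derivative
        a + b * cos x + c * (cos x)\<^sup>2) (at x within {0..2 * pi})"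
      unfolding has_real_derivative_iff_has_vector_derivative[symmetric]
      by (auto intro!: derivative_eq_intros simp: field_simps)
  qed simp
  then show ?thesis by (simp add: algebra_simps)
qed

lemma bessel_I0_ge_1: "1 \<le> bessel_I0 \<kappa>"
  using bessel_I0_ge[of "\<lambda>u. 1 + \<kappa> * cos u + 0 * (cos u)\<^sup>2" \<kappa>]
    has_integral_cos_poly[of 1 \<kappa> 0]
  by (auto simp: has_integral_iff)

lemma bessel_I0_pos [simp]: "0 < bessel_I0 \<kappa>"
  using bessel_I0_ge_1[of \<kappa>] by linarith

lemma bessel_I0_neq_0 [simp]: "bessel_I0 \<kappa> \<noteq> 0"
  using bessel_I0_pos[of \<kappa>] by linarith

lemma bessel_I0_le_exp: "0 \<le> \<kappa> \<Longrightarrow> bessel_I0 \<kappa> \<le> exp \<kappa>"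
  using bessel_I0_mono[of \<kappa> "\<lambda>_. exp \<kappa>"] by (simp add: mult_left_le integrable_const_ivl)

lemma continuous_on_bessel_I0: "continuous_on A bessel_I0"
proof -
  have "continuous_on UNIV (\<lambda>\<kappa>. integral (cbox 0 (2 * pi)) (\<lambda>u. exp (\<kappa> * cos u)))"
    by (rule integral_continuous_on_param) (auto intro!: continuous_intros simp: split_beta)
  then have "continuous_on A (\<lambda>\<kappa>. integral {0..2 * pi} (\<lambda>u. exp (\<kappa> * cos u)))"
    by (auto intro: continuous_on_subset)
  then show ?thesis
    unfolding bessel_I0_def [abs_def] by (intro continuous_intros)
qed

text \<open>The cubic error keeps the constant one half of the quadratic term sharp; it is this constant that
  decides the value of the exponent when \<open>\<kappa>\<close> tends to 0.\<close>
lemma exp_quadratic_bounds: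
  fixes x :: real
  assumes "\<bar>x\<bar> \<le> 1"
  shows "exp x \<le> 1 + x + x\<^sup>2 / 2 + \<bar>x\<bar> ^ 3" "1 + x + x\<^sup>2 / 2 - \<bar>x\<bar> ^ 3 \<le> exp x"
proof -
  obtain t where t: "\<bar>t\<bar> \<le> \<bar>x\<bar>" "exp x = (\<Sum>m<3. (x ^ m) / fact m) + (exp t / fact 3) * x ^ 3"
    using Maclaurin_exp_le by blast
  have "exp t \<le> exp 1" using t(1) assms by simp
  also have "exp (1::real) \<le> 3" by (rule exp_le)
  finally have "exp t / 6 \<le> 1" by simp
  then have "\<bar>(exp t / 6) * x ^ 3\<bar> \<le> \<bar>x\<bar> ^ 3"
    using mult_left_le_one_le[of "\<bar>x\<bar> ^ 3" "exp t / 6"] by (simp add: abs_mult power_abs)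
  moreover have "exp x = 1 + x + x\<^sup>2 / 2 + (exp t / 6) * x ^ 3"
    using t(2) by (simp add: numeral_3_eq_3 fact_numeral power2_eq_square)
  ultimately show "exp x \<le> 1 + x + x\<^sup>2 / 2 + \<bar>x\<bar> ^ 3" "1 + x + x\<^sup>2 / 2 - \<bar>x\<bar> ^ 3 \<le> exp x"
    by linarith+
qed

lemma bessel_I0_near_0:
  assumes "0 \<le> \<kappa>" "\<kappa> \<le> 1"
  shows "bessel_I0 \<kappa> \<le> 1 + \<kappa>\<^sup>2 / 4 + \<kappa> ^ 3" "1 + \<kappa>\<^sup>2 / 4 - \<kappa> ^ 3 \<le> bessel_I0 \<kappa>"
proof -
  have le1: "\<bar>\<kappa> * cos u\<bar> \<le> \<kappa>" for u
    using assms by (simp add: abs_mult mult_left_le)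
  then have cube: "\<bar>\<kappa> * cos u\<bar> ^ 3 \<le> \<kappa> ^ 3" for u by (intro power_mono) auto
  have q: "\<bar>\<kappa> * cos u\<bar> \<le> 1" for u using le1[of u] assms by linarith
  have "bessel_I0 \<kappa> \<le> 1 / (2 * pi) * integral {0..2 * pi}
      (\<lambda>u. (1 + \<kappa> ^ 3) + \<kappa> * cos u + \<kappa>\<^sup>2 / 2 * (cos u)\<^sup>2)"
  proof (rule bessel_I0_mono)
    fix u :: real
    show "exp (\<kappa> * cos u) \<le> (1 + \<kappa> ^ 3) + \<kappa> * cos u + \<kappa>\<^sup>2 / 2 * (cos u)\<^sup>2"
      using exp_quadratic_bounds(1)[OF q[of u]] cube[of u] by (simp add: power_mult_distrib)
  qed (use has_integral_cos_poly in blast)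
  then show "bessel_I0 \<kappa> \<le> 1 + \<kappa>\<^sup>2 / 4 + \<kappa> ^ 3"
    using has_integral_cos_poly[of "1 + \<kappa> ^ 3" \<kappa> "\<kappa>\<^sup>2 / 2"] by (simp add: has_integral_iff)
  have "1 / (2 * pi) * integral {0..2 * pi}
      (\<lambda>u. (1 - \<kappa> ^ 3) + \<kappa> * cos u + \<kappa>\<^sup>2 / 2 * (cos u)\<^sup>2) \<le> bessel_I0 \<kappa>"
  proof (rule bessel_I0_ge)
    fix u :: real
    show "(1 - \<kappa> ^ 3) + \<kappa> * cos u + \<kappa>\<^sup>2 / 2 * (cos u)\<^sup>2 \<le> exp (\<kappa> * cos u)"
      using exp_quadratic_bounds(2)[OF q[of u]] cube[of u] by (simp add: power_mult_distrib)
  qed (use has_integral_cos_poly in blast)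
  then show "1 + \<kappa>\<^sup>2 / 4 - \<kappa> ^ 3 \<le> bessel_I0 \<kappa>"
    using has_integral_cos_poly[of "1 - \<kappa> ^ 3" \<kappa> "\<kappa>\<^sup>2 / 2"] by (simp add: has_integral_iff)
qed

lemma bessel_ratio_pos [simp]: "0 < bessel_ratio \<kappa>"
  unfolding bessel_ratio_def by (intro divide_pos_pos zero_less_power bessel_I0_pos)

lemma ln_bessel_ratio:
  "ln (bessel_ratio \<kappa>) = ln (bessel_I0 (2 * \<kappa>)) - 2 * ln (bessel_I0 \<kappa>)"
  unfolding bessel_ratio_def using bessel_I0_pos
  by (subst ln_div) (auto simp: ln_realpow less_imp_neq[symmetric])

text \<open>To second order, \<open>ln I0(x)\<close> is \<open>x^2 / 4\<close>, so \<open>ln R = ln I0(2\<kappa>) - 2 ln I0(\<kappa>)\<close> is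
  \<open>\<kappa>^2 - \<kappa>^2 / 2 = \<kappa>^2 / 2\<close>.\<close>
lemma ln_bessel_ratio_near_0:
  assumes "1 / 2 < a"
  shows "\<exists>\<kappa>\<^sub>0>0. \<forall>\<kappa>. 0 < \<kappa> \<and> \<kappa> < \<kappa>\<^sub>0 \<longrightarrow> ln (bessel_ratio \<kappa>) \<le> a * \<kappa>\<^sup>2"
proof -
  let ?f = "\<lambda>\<kappa>::real. (ln (1 + \<kappa>\<^sup>2 + 8 * \<kappa> ^ 3) - 2 * ln (1 + \<kappa>\<^sup>2 / 4 - \<kappa> ^ 3)) / \<kappa>\<^sup>2"
  have "(?f \<longlongrightarrow> 1 / 2) (at_right 0)" by real_asymp
  then have "\<forall>\<^sub>F \<kappa> in at_right 0. ?f \<kappa> < a"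
    using assms by (rule order_tendstoD)
  moreover have "\<forall>\<^sub>F \<kappa>::real in at_right 0. 1 + \<kappa>\<^sup>2 / 4 - \<kappa> ^ 3 > 0" by real_asymp
  moreover have "\<forall>\<^sub>F \<kappa>::real in at_right 0. \<kappa> < 1 / 2" by real_asymp
  ultimately have "\<forall>\<^sub>F \<kappa> in at_right 0. ln (bessel_ratio \<kappa>) \<le> a * \<kappa>\<^sup>2"
    using eventually_at_right_less[of "0::real"]
  proof eventually_elim
    case (elim \<kappa>)
    have "ln (bessel_ratio \<kappa>) = ln (bessel_I0 (2 * \<kappa>)) - 2 * ln (bessel_I0 \<kappa>)"
      by (rule ln_bessel_ratio)
    also have "\<dots> \<le> ln (1 + \<kappa>\<^sup>2 + 8 * \<kappa> ^ 3) - 2 * ln (1 + \<kappa>\<^sup>2 / 4 - \<kappa> ^ 3)"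
    proof -
      have "bessel_I0 (2 * \<kappa>) \<le> 1 + \<kappa>\<^sup>2 + 8 * \<kappa> ^ 3"
        using bessel_I0_near_0(1)[of "2 * \<kappa>"] elim by (simp add: power_mult_distrib)
      then have "ln (bessel_I0 (2 * \<kappa>)) \<le> ln (1 + \<kappa>\<^sup>2 + 8 * \<kappa> ^ 3)"
        by (intro ln_mono) auto
      moreover have "ln (1 + \<kappa>\<^sup>2 / 4 - \<kappa> ^ 3) \<le> ln (bessel_I0 \<kappa>)"
        using bessel_I0_near_0(2)[of \<kappa>] elim by (intro ln_mono) auto
      ultimately show ?thesis by linarith
    qed
    also have "\<dots> \<le> a * \<kappa>\<^sup>2" using elim by (simp add: field_simps)
    finally show ?case .
  qed
  then show ?thesis by (auto simp: eventually_at_right_field)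
qed

text \<open>The fourth order Taylor polynomial bounds \<open>cos\<close> from above, and the quartic term costs at most
  \<open>10 / 24\<close> of \<open>x^2\<close> because \<open>pi^2 < 10\<close>.\<close>
lemma cos_le_quadratic:
  fixes x :: real
  assumes "\<bar>x\<bar> \<le> pi"
  shows "cos x \<le> 1 - x\<^sup>2 / 12"
proof -
  obtain t where "cos x = (\<Sum>m<4. cos_coeff m * x ^ m) + (cos (t + 1/2 * real 4 * pi) / fact 4) * x ^ 4"
    using Maclaurin_cos_expansion by blast
  moreover have "(\<Sum>m<4. f m) = f 0 + f 1 + f 2 + f 3" for f :: "nat \<Rightarrow> real"
    by (simp add: eval_nat_numeral)
  ultimately have eq: "cos x = 1 - x\<^sup>2 / 2 + cos t / 24 * x ^ 4"
    by (simp add: cos_coeff_def fact_numeral)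
  have "cos t * x ^ 4 \<le> 1 * x ^ 4" by (intro mult_right_mono) auto
  also have "\<dots> \<le> x\<^sup>2 * 10"
  proof -
    have "\<bar>x\<bar> \<le> 315 / 100" using assms pi_approx by simp
    then have "\<bar>x\<bar>\<^sup>2 \<le> (315 / 100)\<^sup>2" by (intro power_mono) auto
    then have "x\<^sup>2 \<le> 10" by (simp add: power2_eq_square)
    then have "x\<^sup>2 * x\<^sup>2 \<le> x\<^sup>2 * 10" by (intro mult_left_mono) auto
    then show ?thesis by (simp add: power_add[symmetric])
  qed
  finally show ?thesis using eq by simp
qed

text \<open>The integrand concentrates where \<open>cos\<close> is near 1. Shifting by \<open>pi\<close> puts this point in the middle
  of the interval of integration, and \<open>exp (- y) \<le> 1 / (1 + y)\<close> replaces the Gaussian integral by one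
  with the elementary primitive \<open>arctan\<close>, at the cost of a constant factor.\<close>
lemma bessel_I0_upper:
  assumes "0 < \<kappa>"
  shows "bessel_I0 \<kappa> \<le> 2 * exp \<kappa> / sqrt \<kappa>"
proof -
  \<comment> \<open>The constant in \<open>cos_le_quadratic\<close>, scaled so that \<open>\<kappa> * y^2 / 12 = (a * y)^2\<close>.\<close>
  define a where "a = sqrt (\<kappa> / 12)"
  have a: "a > 0" "a\<^sup>2 = \<kappa> / 12" using assms by (auto simp: a_def)
  let ?g = "\<lambda>u. exp \<kappa> / (1 + (a * (u - pi))\<^sup>2)"
  let ?G = "\<lambda>u. exp \<kappa> / a * arctan (a * (u - pi))"
  have "(?g has_integral ?G (2 * pi) - ?G 0) {0..2 * pi}"
  proof (rule fundamental_theorem_of_calculus)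
    fix x :: real
    have "1 + (a * (x - pi))\<^sup>2 \<noteq> 0" by (auto simp: add_nonneg_eq_0_iff)
    then show "(?G has_vector_derivative ?g x) (at x within {0..2 * pi})"
      unfolding has_real_derivative_iff_has_vector_derivative[symmetric] using a(1)
      by (auto intro!: derivative_eq_intros simp: inverse_eq_divide)
  qed auto
  moreover have "?G 0 = - ?G (2 * pi)" by (simp add: arctan_minus)
  ultimately have int_g: "integral {0..2 * pi} ?g = exp \<kappa> / a * (2 * arctan (a * pi))"
    by (simp add: has_integral_iff algebra_simps)
  have "bessel_I0 \<kappa> = 1 / (2 * pi) * integral {0..2 * pi} (\<lambda>u. exp (\<kappa> * cos (u - pi)))"
    by (rule bessel_I0_shift) auto
  also have "\<dots> \<le> 1 / (2 * pi) * integral {0..2 * pi} ?g"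
  proof (intro mult_left_mono integral_le integrable_continuous_real continuous_intros ballI)
    fix u assume "u \<in> {0..2 * pi}"
    then have "\<bar>u - pi\<bar> \<le> pi" by (auto simp: abs_if)
    then have "\<kappa> * cos (u - pi) \<le> \<kappa> * (1 - (u - pi)\<^sup>2 / 12)"
      using assms by (intro mult_left_mono cos_le_quadratic) auto
    also have "\<dots> = \<kappa> - (a * (u - pi))\<^sup>2" unfolding power_mult_distrib a(2) by (simp add: right_diff_distrib)
    finally have "exp (\<kappa> * cos (u - pi)) \<le> exp \<kappa> / exp ((a * (u - pi))\<^sup>2)"
      by (simp add: exp_diff[symmetric])
    also have "\<dots> \<le> ?g u"
      by (intro divide_left_mono exp_ge_add_one_self) (auto intro!: mult_pos_pos add_pos_nonneg)
    finally show "exp (\<kappa> * cos (u - pi)) \<le> ?g u" .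
  next
    fix u show "1 + (a * (u - pi))\<^sup>2 \<noteq> 0" by (auto simp: add_nonneg_eq_0_iff)
  qed auto
  also have "\<dots> = 1 / (2 * pi) * (exp \<kappa> / a * (2 * arctan (a * pi)))"
    unfolding int_g ..
  also have "\<dots> \<le> 1 / (2 * pi) * (exp \<kappa> / a * pi)"
    using arctan_ubound[of "a * pi"] a(1) by (intro mult_left_mono) auto
  also have "\<dots> = sqrt 12 / 2 * exp \<kappa> / sqrt \<kappa>"
    using assms by (simp add: a_def real_sqrt_divide)
  also have "\<dots> \<le> 2 * exp \<kappa> / sqrt \<kappa>"
  proof -
    have "sqrt 12 \<le> (4::real)" by (rule real_le_lsqrt) auto
    then show ?thesis using assms by (intro divide_right_mono mult_right_mono) auto
  qed
  finally show ?thesis .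
qed

text \<open>On the interval of length \<open>1 / sqrt \<kappa>\<close> next to 0 the exponent is within one half of its
  maximum.\<close>
lemma bessel_I0_lower:
  assumes "1 \<le> \<kappa>"
  shows "exp \<kappa> / (20 * sqrt \<kappa>) \<le> bessel_I0 \<kappa>"
proof -
  define b where "b = 1 / sqrt \<kappa>"
  have b: "0 < b" "b \<le> 1" "\<kappa> * b\<^sup>2 = 1" using assms by (auto simp: b_def power_divide)
  have "exp (\<kappa> - 1 / 2) * b = integral {0..b} (\<lambda>u. exp (\<kappa> - 1 / 2))" using b by simp
  also have "\<dots> \<le> integral {0..b} (\<lambda>u. exp (\<kappa> * cos u))"
  proof (intro integral_le integrable_continuous_real continuous_intros)
    fix u assume u: "u \<in> {0..b}"
    have "1 - u\<^sup>2 / 2 \<le> cos u"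
      using cos_double_sin[of "u / 2"] abs_le_square_iff[THEN iffD1, OF abs_sin_x_le_abs_x[of "u / 2"]]
      by (simp add: power_divide)
    then have "\<kappa> * (1 - u\<^sup>2 / 2) \<le> \<kappa> * cos u" using assms by (intro mult_left_mono) auto
    moreover have "\<kappa> * u\<^sup>2 \<le> \<kappa> * b\<^sup>2" using u assms by (intro mult_left_mono power_mono) auto
    ultimately have "\<kappa> - 1 / 2 \<le> \<kappa> * cos u" using b(3) by (simp add: algebra_simps)
    then show "exp (\<kappa> - 1 / 2) \<le> exp (\<kappa> * cos u)" by simp
  qed
  also have "\<dots> \<le> integral {0..2 * pi} (\<lambda>u. exp (\<kappa> * cos u))"
  proof (intro integral_subset_le integrable_continuous_real continuous_intros)
    show "{0..b} \<subseteq> {0..2 * pi}" using b pi_gt3 by auto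
  qed auto
  finally have "1 / (2 * pi) * (exp (\<kappa> - 1 / 2) * b) \<le> bessel_I0 \<kappa>"
    unfolding bessel_I0_def by (intro mult_left_mono) auto
  moreover have "exp \<kappa> / (20 * sqrt \<kappa>) \<le> 1 / (2 * pi) * (exp (\<kappa> - 1 / 2) * b)"
  proof -
    have "exp (1 / 2 :: real) \<le> exp 1" by simp
    then have "exp (1 / 2 :: real) \<le> 3" using exp_le by linarith
    moreover have "pi * exp (1 / 2) \<le> 3.2 * 3" 
      using pi_approx calculation by (intro mult_mono) auto
    ultimately have "2 * pi * exp (1 / 2) \<le> 20" by simp
    then have "exp \<kappa> / (20 * sqrt \<kappa>) \<le> exp \<kappa> / ((2 * pi * exp (1 / 2)) * sqrt \<kappa>)"
      using assms by (intro divide_left_mono mult_right_mono) auto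
    then show ?thesis unfolding b_def exp_diff by (simp add: mult_ac)
  qed
  ultimately show ?thesis by linarith
qed

text \<open>For \<open>\<kappa> > 1\<close>, the factors \<open>exp (2\<kappa>)\<close> cancel, and the square roots in the two bounds on \<open>I0\<close> leave
  \<open>\<kappa> / sqrt (2\<kappa>)\<close>.\<close>
lemma bessel_ratio_upper:
  "\<exists>A\<ge>1. \<forall>\<kappa>>0. bessel_ratio \<kappa> \<le> A * sqrt (max 1 \<kappa>)"
proof (intro exI conjI allI impI)
  show "(800::real) \<ge> 1" by simp
  fix \<kappa> :: real assume \<kappa>: "0 < \<kappa>"
  show "bessel_ratio \<kappa> \<le> 800 * sqrt (max 1 \<kappa>)"
  proof (cases "\<kappa> \<le> 1")
    case True
    have "bessel_ratio \<kappa> \<le> bessel_I0 (2 * \<kappa>) / 1"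
      unfolding bessel_ratio_def using bessel_I0_ge_1[of \<kappa>]
      by (intro divide_left_mono) (auto simp: less_imp_le one_le_power)
    also have "\<dots> \<le> exp (2 * \<kappa>)" using bessel_I0_le_exp[of "2 * \<kappa>"] \<kappa> by simp
    also have "\<dots> \<le> exp 1 * exp 1" using True by (simp add: exp_add[symmetric])
    also have "\<dots> \<le> 3 * 3" using exp_le by (intro mult_mono) auto
    finally show ?thesis using True by simp
  next
    case False
    have "bessel_ratio \<kappa> \<le> (2 * exp (2 * \<kappa>) / sqrt (2 * \<kappa>)) / (exp \<kappa> / (20 * sqrt \<kappa>))\<^sup>2"
      unfolding bessel_ratio_def using \<kappa> False
      by (intro frac_le power_mono bessel_I0_upper bessel_I0_lower zero_less_power) auto
    also have "\<dots> = 800 / sqrt 2 * (\<kappa> / sqrt \<kappa>)"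
      using \<kappa> by (simp add: real_sqrt_mult power_divide power_mult_distrib exp_double[symmetric] field_simps)
    also have "\<dots> \<le> 800 * sqrt \<kappa>"
      using \<kappa> by (subst real_div_sqrt, simp, intro mult_right_mono) (auto simp: field_simps)
    finally show ?thesis using False by simp
  qed
qed

lemma bessel_ratio_lower:
  assumes "1 \<le> \<kappa>"
  shows "sqrt \<kappa> / 160 \<le> bessel_ratio \<kappa>"
proof -
  have "sqrt 2 \<le> (2::real)" by (rule real_le_lsqrt) auto
  then have "sqrt \<kappa> / 160 \<le> sqrt \<kappa> / (80 * sqrt 2)" using assms by (intro divide_left_mono) auto
  also have "\<dots> = (\<kappa> / sqrt \<kappa>) / (80 * sqrt 2)" using assms by (simp add: real_div_sqrt)
  also have "\<dots> = (exp (2 * \<kappa>) / (20 * sqrt (2 * \<kappa>))) / (2 * exp \<kappa> / sqrt \<kappa>)\<^sup>2"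
    using assms by (simp add: real_sqrt_mult power_divide power_mult_distrib exp_double[symmetric] field_simps)
  also have "\<dots> \<le> bessel_ratio \<kappa>"
    unfolding bessel_ratio_def using assms
    by (intro frac_le power_mono bessel_I0_upper bessel_I0_lower zero_less_power) (auto simp: less_imp_le)
  finally show ?thesis .
qed

text \<open>Cauchy--Schwarz for \<open>exp (\<kappa> cos u / 2)\<close> and \<open>exp (\<kappa> cos u)\<close>. Equality would make their quotient
  constant, which it is not because \<open>cos\<close> differs at 0 and \<open>pi\<close>.\<close>
lemma bessel_I0_strict_log_convex:
  assumes "\<kappa> \<noteq> 0"
  shows "(bessel_I0 (3 / 2 * \<kappa>))\<^sup>2 < bessel_I0 \<kappa> * bessel_I0 (2 * \<kappa>)"
proof -
  \<comment> \<open>The value of \<open>l\<close> minimising the integral of \<open>exp (\<kappa> cos u) * (exp (\<kappa> cos u / 2) - l)^2\<close>.\<close>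
  define l where "l = bessel_I0 (3 / 2 * \<kappa>) / bessel_I0 \<kappa>"
  let ?h = "\<lambda>u. exp (\<kappa> * cos u) * (exp (\<kappa> / 2 * cos u) - l)\<^sup>2"
  have h: "?h u = exp (2 * \<kappa> * cos u) - 2 * l * exp (3 / 2 * \<kappa> * cos u) + l\<^sup>2 * exp (\<kappa> * cos u)" for u
  proof -
    have "exp (2 * \<kappa> * cos u) = exp (\<kappa> * cos u) * (exp (\<kappa> / 2 * cos u))\<^sup>2"
      "exp (3 / 2 * \<kappa> * cos u) = exp (\<kappa> * cos u) * exp (\<kappa> / 2 * cos u)"
      by (simp_all add: exp_add[symmetric] exp_double[symmetric])
    then show ?thesis by (simp add: power2_eq_square algebra_simps)
  qed
  have cont: "continuous_on {0..2 * pi} ?h" by (intro continuous_intros)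
  have "\<not> (\<forall>u\<in>{0..2 * pi}. ?h u = 0)"
  proof
    assume "\<forall>u\<in>{0..2 * pi}. ?h u = 0"
    then have "?h 0 = 0" "?h pi = 0"
      by (rule bspec, simp)+
    then have "exp (\<kappa> / 2) = exp (- \<kappa> / 2)" by simp
    then show False using assms by (simp only: exp_inj_iff)
  qed
  then have "integral {0..2 * pi} ?h \<noteq> 0" using integral_eq_0_iff[OF cont] by auto
  moreover have "0 \<le> integral {0..2 * pi} ?h"
    by (intro integral_nonneg integrable_continuous_real cont) auto
  ultimately have "0 < 1 / (2 * pi) * integral {0..2 * pi} ?h" by simp
  also have "\<dots> = bessel_I0 (2 * \<kappa>) - 2 * l * bessel_I0 (3 / 2 * \<kappa>) + l\<^sup>2 * bessel_I0 \<kappa>"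
    unfolding h bessel_I0_def
    by (simp add: integral_add integral_diff integrable_continuous_real continuous_intros
        algebra_simps)
  also have "\<dots> = bessel_I0 (2 * \<kappa>) - (bessel_I0 (3 / 2 * \<kappa>))\<^sup>2 / bessel_I0 \<kappa>"
    using bessel_I0_pos[of \<kappa>] by (simp add: l_def power2_eq_square field_simps)
  finally show ?thesis using bessel_I0_pos[of \<kappa>] by (simp add: field_simps)
qed

section \<open>Overlap of random subsets\<close>

text \<open>The left side counts the \<open>k\<close>-subsets that contain \<open>m\<close> prescribed points. Requiring one point at
  a time multiplies the proportion of such subsets by \<open>(k - j) / (n - j) \<le> k / n\<close>.\<close>
lemma binomial_diff_le:
  assumes "m \<le> k" "k \<le> n" "0 < n"
  shows "real ((n - m) choose (k - m)) \<le> (real k / real n) ^ m * real (n choose k)"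
  using assms(1)
proof (induction m)
  case (Suc m)
  have pos: "0 < n - m" "0 < k - m" using Suc.prems assms by auto
  have "real (k - m) * real ((n - m) choose (k - m)) = real (n - m) * real ((n - Suc m) choose (k - Suc m))"
    using times_binomial_minus1_eq[OF pos(2), of "n - m"]
    unfolding of_nat_mult[symmetric] of_nat_eq_iff by simp
  then have "real ((n - Suc m) choose (k - Suc m))
      = real (k - m) / real (n - m) * real ((n - m) choose (k - m))"
    using pos by (simp add: field_simps)
  also have "\<dots> \<le> real k / real n * ((real k / real n) ^ m * real (n choose k))"
  proof (rule mult_mono)
    have "real m * real k \<le> real m * real n" using assms by (intro mult_left_mono) auto
    then show "real (k - m) / real (n - m) \<le> real k / real n"
      using pos assms Suc.prems by (simp add: field_simps of_nat_diff)
  qed (use Suc in auto)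
  finally show ?case by (simp add: mult_ac)
qed simp

lemma card_supersets_le:
  assumes "finite A" "S \<subseteq> A"
  shows "card {C. C \<subseteq> A \<and> card C = k \<and> S \<subseteq> C} \<le> (card A - card S) choose (k - card S)"
proof -
  have fin: "finite S" using assms finite_subset by blast
  have "card {C. C \<subseteq> A \<and> card C = k \<and> S \<subseteq> C} \<le> card {D. D \<subseteq> A - S \<and> card D = k - card S}"
  proof (rule card_inj_on_le[where f = "\<lambda>C. C - S"])
    show "inj_on (\<lambda>C. C - S) {C. C \<subseteq> A \<and> card C = k \<and> S \<subseteq> C}"
      by (auto simp: inj_on_def)
    show "(\<lambda>C. C - S) ` {C. C \<subseteq> A \<and> card C = k \<and> S \<subseteq> C} \<subseteq> {D. D \<subseteq> A - S \<and> card D = k - card S}"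
      using fin by (auto simp: card_Diff_subset)
    show "finite {D. D \<subseteq> A - S \<and> card D = k - card S}"
      using assms(1) by simp
  qed
  also have "\<dots> = (card A - card S) choose (k - card S)"
    using assms fin by (simp add: n_subsets card_Diff_subset)
  finally show ?thesis .
qed

text \<open>A union bound over the \<open>m\<close>-subsets of \<open>C'\<close> that \<open>C\<close> has to contain. There are at most \<open>k ^ m\<close>
  of them, each contained in a proportion of at most \<open>(k / n) ^ m\<close> of the sets \<open>C\<close>.\<close>
lemma card_overlap_le:
  assumes A: "finite A" "card A = n" "0 < n" and C': "C' \<subseteq> A" "card C' = k" and m: "m \<le> k"
  shows "real (card {C. C \<subseteq> A \<and> card C = k \<and> card (C \<inter> C') = m})
    \<le> ((real k)\<^sup>2 / real n) ^ m * real (n choose k)"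
proof -
  have fin: "finite C'" using A C' finite_subset by blast
  have kn: "k \<le> n" using A C' card_mono by blast
  let ?\<S> = "{S. S \<subseteq> C' \<and> card S = m}"
  have finS: "finite ?\<S>" using fin by simp
  let ?F = "\<lambda>S. {C. C \<subseteq> A \<and> card C = k \<and> S \<subseteq> C}"
  have "{C. C \<subseteq> A \<and> card C = k \<and> card (C \<inter> C') = m} \<subseteq> (\<Union>S\<in>?\<S>. ?F S)"
    by auto
  then have "card {C. C \<subseteq> A \<and> card C = k \<and> card (C \<inter> C') = m} \<le> card (\<Union>S\<in>?\<S>. ?F S)"
    using finS A(1) by (intro card_mono finite_UN_I) auto
  also have "\<dots> \<le> (\<Sum>S\<in>?\<S>. card (?F S))" by (rule card_UN_le[OF finS])
  also have "\<dots> \<le> (\<Sum>S\<in>?\<S>. (n - m) choose (k - m))"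
    using card_supersets_le[OF A(1)] A(2) C'(1) by (intro sum_mono) fastforce
  also have "\<dots> = (k choose m) * ((n - m) choose (k - m))"
    using n_subsets[OF fin, of m] C'(2) by simp
  finally have "real (card {C. C \<subseteq> A \<and> card C = k \<and> card (C \<inter> C') = m})
      \<le> real (k choose m) * real ((n - m) choose (k - m))"
    unfolding of_nat_mult[symmetric] of_nat_le_iff .
  also have "\<dots> \<le> real k ^ m * ((real k / real n) ^ m * real (n choose k))"
  proof (rule mult_mono)
    show "real (k choose m) \<le> real k ^ m"
      using binomial_le_pow[OF m] by (metis of_nat_le_iff of_nat_power)
  qed (use binomial_diff_le[OF m kn A(3)] in auto)
  finally show ?thesis by (simp add: power_divide power_mult_distrib power2_eq_square)
qed

text \<open>Overlaps 0 and 1 come without a common edge, so 1 is the natural bound on \<open>B\<close> there; whatever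
  their probabilities are, they contribute at most 1 in total.\<close>
lemma average_overlap_le:
  fixes B :: "nat \<Rightarrow> real"
  assumes A: "finite A" "card A = n" "0 < n" and C': "C' \<subseteq> A" "card C' = k"
    and B: "\<And>m. 0 \<le> B m" "B 0 \<le> 1" "B 1 \<le> 1"
  shows "(\<Sum>C | C \<subseteq> A \<and> card C = k. B (card (C \<inter> C'))) / real (n choose k)
    \<le> 1 + (\<Sum>m=2..k. ((real k)\<^sup>2 / real n) ^ m * B m)"
proof -
  let ?\<C> = "{C. C \<subseteq> A \<and> card C = k}"
  have fin: "finite ?\<C>" using A(1) by simp
  have kn: "k \<le> n" using A C' card_mono by blast
  then have pos: "0 < real (n choose k)" by simp
  have "B (card (C \<inter> C')) \<le> 1 + (\<Sum>m=2..k. of_bool (card (C \<inter> C') = m) * B m)" if "C \<in> ?\<C>" for C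
  proof -
    have "card (C \<inter> C') \<le> k" using A C' by (metis card_mono finite_subset inf_le2)
    moreover have "(\<Sum>m=2..k. of_bool (card (C \<inter> C') = m) * B m)
        = (if card (C \<inter> C') \<in> {2..k} then B (card (C \<inter> C')) else 0)"
    proof -
      have "of_bool (card (C \<inter> C') = m) * B m = (if card (C \<inter> C') = m then B m else 0)" for m
        by simp
      then show ?thesis by (simp only: sum.delta' finite_atLeastAtMost)
    qed
    moreover have "card (C \<inter> C') = 0 \<or> card (C \<inter> C') = 1 \<or> 2 \<le> card (C \<inter> C')" by linarith
    ultimately show ?thesis using B by auto
  qed
  then have "(\<Sum>C\<in>?\<C>. B (card (C \<inter> C')))
      \<le> (\<Sum>C\<in>?\<C>. 1 + (\<Sum>m=2..k. of_bool (card (C \<inter> C') = m) * B m))"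
    by (intro sum_mono)
  also have "\<dots> = real (n choose k) + (\<Sum>m=2..k. (\<Sum>C\<in>?\<C>. of_bool (card (C \<inter> C') = m)) * B m)"
    unfolding sum.distrib sum_distrib_right using n_subsets[OF A(1), of k] A(2)
    by (subst sum.swap) simp
  also have "\<dots> \<le> real (n choose k)
      + (\<Sum>m=2..k. (((real k)\<^sup>2 / real n) ^ m * real (n choose k)) * B m)"
  proof (intro add_left_mono sum_mono mult_right_mono B)
    fix m assume m: "m \<in> {2..k}"
    have "(\<Sum>C\<in>?\<C>. of_bool (card (C \<inter> C') = m) :: real)
        = real (card {C. C \<subseteq> A \<and> card C = k \<and> card (C \<inter> C') = m})"
      using fin by (simp add: of_bool_def sum.If_cases Int_def conj_ac)
    then show "(\<Sum>C\<in>?\<C>. of_bool (card (C \<inter> C') = m)) \<le> ((real k)\<^sup>2 / real n) ^ m * real (n choose k)"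
      using card_overlap_le[OF A C', of m] m by simp
  qed
  also have "\<dots> = real (n choose k) * (1 + (\<Sum>m=2..k. ((real k)\<^sup>2 / real n) ^ m * B m))"
    by (simp add: algebra_simps sum_distrib_left)
  finally show ?thesis using pos by (simp add: field_simps)
qed

section \<open>Likelihood ratios and their moments\<close>

lemma space_uniform_angle: "space uniform_angle = {0..<2 * pi}"
  by (simp add: uniform_angle_def angles_def uniform_measure_def space_restrict_space)

lemma space_angles: "space angles = {0..<2 * pi}"
  by (simp add: angles_def space_restrict_space)

lemma sets_angles: "sets angles = sets (restrict_space borel {0..<2 * pi})"
  unfolding angles_def by (rule sets_restrict_space_cong) simp

lemma sets_uniform_angle: "sets uniform_angle = sets (restrict_space borel {0..<2 * pi})"
  using sets_angles by (simp add: uniform_angle_def)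

lemma measurable_uniform_angle_ident [measurable]: "(\<lambda>x. x) \<in> borel_measurable uniform_angle"
  unfolding measurable_cong_sets[OF sets_uniform_angle refl]
  by (intro measurable_restrict_space1) simp

lemma measurable_angles_ident [measurable]: "(\<lambda>x. x) \<in> borel_measurable angles"
  unfolding measurable_cong_sets[OF sets_angles refl]
  by (intro measurable_restrict_space1) simp

lemma emeasure_angles: "emeasure angles {0..<2 * pi} = ennreal (2 * pi)"
  unfolding angles_def by (subst emeasure_restrict_space) auto

lemma angles_full [measurable]: "{0..<2 * pi} \<in> sets angles"
  unfolding angles_def by (auto simp: sets_restrict_space_iff)

lemma prob_space_uniform_angle: "prob_space uniform_angle"
  unfolding uniform_angle_def by (rule prob_space_uniform_measure) (simp_all add: emeasure_angles)

text \<open>Written as a density, \<open>uniform_angle\<close> has the same base measure as \<open>von_mises\<close>, so that a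
  density ratio between the two can be read off.\<close>
lemma uniform_angle_eq_density: "uniform_angle = density angles (\<lambda>x. ennreal (1 / (2 * pi)))"
  unfolding uniform_angle_def uniform_measure_def
proof (rule density_cong)
  show "AE x in angles. indicator {0..<2 * pi} x / emeasure angles {0..<2 * pi} = ennreal (1 / (2 * pi))"
    by (rule AE_I2) (auto simp: emeasure_angles space_angles divide_ennreal[symmetric])
qed auto

lemma nn_integral_uniform_angle:
  fixes f :: "real \<Rightarrow> real"
  assumes [measurable]: "f \<in> borel_measurable borel" and f: "\<And>x. 0 \<le> f x"
    and int: "(f has_integral I) {0..2 * pi}"
  shows "(\<integral>\<^sup>+x. ennreal (f x) \<partial>uniform_angle) = ennreal (1 / (2 * pi) * I)"
proof -
  have m: "(\<lambda>x. ennreal (f x)) \<in> borel_measurable angles" by measurable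
  have "(\<integral>\<^sup>+x. ennreal (f x) \<partial>uniform_angle) = ennreal (1 / (2 * pi)) * (\<integral>\<^sup>+x. ennreal (f x) \<partial>angles)"
    unfolding uniform_angle_eq_density by (simp add: nn_integral_density nn_integral_cmult m)
  also have "(\<integral>\<^sup>+x. ennreal (f x) \<partial>angles) = (\<integral>\<^sup>+x. ennreal (f x) * indicator {0..<2 * pi} x \<partial>lborel)"
    unfolding angles_def by (subst nn_integral_restrict_space) auto
  also have "\<dots> = (\<integral>\<^sup>+x. ennreal (f x) * indicator {0..2 * pi} x \<partial>lborel)"
  proof (rule nn_integral_cong_AE)
    show "AE x in lborel. ennreal (f x) * indicator {0..<2 * pi} x = ennreal (f x) * indicator {0..2 * pi} x"
      using AE_lborel_singleton[of "2 * pi"] by eventually_elim (auto simp: indicator_def)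
  qed
  also have "\<dots> = ennreal I"
  proof -
    have "ennreal (f x) * indicator {0..2 * pi} x = ennreal (indicator {0..2 * pi} x * f x)" for x
      by (simp add: indicator_def)
    then show ?thesis
      using nn_integral_has_integral_lebesgue[OF f int] by (simp add: nn_integral_completion)
  qed
  finally show ?thesis using has_integral_nonneg[OF int f]
    by (simp add: ennreal_mult[symmetric])
qed

lemma nn_integral_exp_cos:
  assumes "0 \<le> \<Theta>" "\<Theta> \<le> 2 * pi"
  shows "(\<integral>\<^sup>+x. ennreal (exp (\<kappa> * cos (x - \<Theta>))) \<partial>uniform_angle) = ennreal (bessel_I0 \<kappa>)"
  unfolding bessel_I0_shift[OF assms]
  by (rule nn_integral_uniform_angle)
     (auto intro!: integrable_integral integrable_continuous_real continuous_intros)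

definition vm_ratio :: "real \<Rightarrow> real \<Rightarrow> real \<Rightarrow> real" where
  "vm_ratio \<kappa> \<Theta> x = exp (\<kappa> * cos (x - \<Theta>)) / bessel_I0 \<kappa>"

lemma vm_ratio_pos: "0 < vm_ratio \<kappa> \<Theta> x"
  by (simp add: vm_ratio_def)

lemma measurable_vm_ratio [measurable]:
  assumes [measurable]: "f \<in> borel_measurable M" "g \<in> borel_measurable M"
  shows "(\<lambda>x. vm_ratio \<kappa> (f x) (g x)) \<in> borel_measurable M"
  unfolding vm_ratio_def by measurable

lemma von_mises_eq_density:
  "von_mises \<Theta> \<kappa> = density uniform_angle (\<lambda>x. ennreal (vm_ratio \<kappa> \<Theta> x))"
proof -
  have "(\<lambda>x. ennreal (vm_ratio \<kappa> \<Theta> x)) \<in> borel_measurable angles" by measurable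
  then show ?thesis
    unfolding von_mises_def uniform_angle_eq_density
    by (subst density_density_eq)
       (auto simp: vm_ratio_def ennreal_mult[symmetric] less_imp_le mult_ac intro!: arg_cong[of _ _ "density angles"])
qed

lemma nn_integral_vm_ratio_powr:
  assumes "0 \<le> \<Theta>" "\<Theta> \<le> 2 * pi"
  shows "(\<integral>\<^sup>+x. ennreal (vm_ratio \<kappa> \<Theta> x powr p) \<partial>uniform_angle)
    = ennreal (bessel_I0 (p * \<kappa>) / bessel_I0 \<kappa> powr p)"
proof -
  have "(\<integral>\<^sup>+x. ennreal (vm_ratio \<kappa> \<Theta> x powr p) \<partial>uniform_angle)
     = (\<integral>\<^sup>+x. ennreal (exp ((p * \<kappa>) * cos (x - \<Theta>))) * ennreal (1 / bessel_I0 \<kappa> powr p) \<partial>uniform_angle)"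
    by (intro nn_integral_cong)
       (simp add: vm_ratio_def powr_divide less_imp_le exp_powr_real ennreal_mult[symmetric] mult_ac)
  also have "\<dots> = ennreal (bessel_I0 (p * \<kappa>)) * ennreal (1 / bessel_I0 \<kappa> powr p)"
    by (subst nn_integral_multc) (auto simp: nn_integral_exp_cos[OF assms])
  finally show ?thesis by (simp add: ennreal_mult[symmetric] less_imp_le)
qed

lemma nn_integral_vm_ratio:
  assumes "0 \<le> \<Theta>" "\<Theta> \<le> 2 * pi"
  shows "(\<integral>\<^sup>+x. ennreal (vm_ratio \<kappa> \<Theta> x) \<partial>uniform_angle) = 1"
  using nn_integral_vm_ratio_powr[OF assms, of \<kappa> 1]
  by (simp add: vm_ratio_pos less_imp_le bessel_I0_pos[THEN less_imp_neq, symmetric])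

text \<open>The exact value depends on the difference of the phases. The inequality
  \<open>2 * a * b \<le> a^2 + b^2\<close> removes this dependence, and both squares have the same integral, which is
  the largest value, attained for equal phases.\<close>
lemma nn_integral_vm_ratio_mult:
  assumes \<Theta>: "0 \<le> \<Theta>" "\<Theta> \<le> 2 * pi" and \<Theta>': "0 \<le> \<Theta>'" "\<Theta>' \<le> 2 * pi"
  shows "(\<integral>\<^sup>+x. ennreal (vm_ratio \<kappa> \<Theta> x * vm_ratio \<kappa> \<Theta>' x) \<partial>uniform_angle) \<le> ennreal (bessel_ratio \<kappa>)"
proof -
  have sq: "(\<integral>\<^sup>+x. ennreal ((vm_ratio \<kappa> t x)\<^sup>2) \<partial>uniform_angle) = ennreal (bessel_ratio \<kappa>)"
    if "0 \<le> t" "t \<le> 2 * pi" for t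
    using nn_integral_vm_ratio_powr[OF that, of \<kappa> 2]
    by (simp add: bessel_ratio_def vm_ratio_pos powr_numeral less_imp_le)
  have "(\<integral>\<^sup>+x. ennreal (vm_ratio \<kappa> \<Theta> x * vm_ratio \<kappa> \<Theta>' x) \<partial>uniform_angle)
      \<le> (\<integral>\<^sup>+x. (ennreal ((vm_ratio \<kappa> \<Theta> x)\<^sup>2) + ennreal ((vm_ratio \<kappa> \<Theta>' x)\<^sup>2)) * ennreal (1 / 2) \<partial>uniform_angle)"
  proof (rule nn_integral_mono)
    fix x
    have "vm_ratio \<kappa> \<Theta> x * vm_ratio \<kappa> \<Theta>' x \<le> ((vm_ratio \<kappa> \<Theta> x)\<^sup>2 + (vm_ratio \<kappa> \<Theta>' x)\<^sup>2) * (1 / 2)"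
      using sum_squares_bound[of "vm_ratio \<kappa> \<Theta> x" "vm_ratio \<kappa> \<Theta>' x"] by simp
    then show "ennreal (vm_ratio \<kappa> \<Theta> x * vm_ratio \<kappa> \<Theta>' x)
        \<le> (ennreal ((vm_ratio \<kappa> \<Theta> x)\<^sup>2) + ennreal ((vm_ratio \<kappa> \<Theta>' x)\<^sup>2)) * ennreal (1 / 2)"
      by (subst ennreal_plus[symmetric], simp, simp, subst ennreal_mult[symmetric]) (auto intro: ennreal_leI)
  qed
  also have "\<dots> = (ennreal (bessel_ratio \<kappa>) + ennreal (bessel_ratio \<kappa>)) * ennreal (1 / 2)"
    by (subst nn_integral_multc, simp, subst nn_integral_add) (auto simp: sq \<Theta> \<Theta>')
  also have "\<dots> = ennreal (bessel_ratio \<kappa>)"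
    by (simp add: ennreal_plus[symmetric] ennreal_mult[symmetric] less_imp_le
        del: ennreal_plus ennreal_half)
  finally show ?thesis .
qed

lemma finite_edges: "finite C \<Longrightarrow> finite (edges C)"
  unfolding edges_def by simp

lemma card_edges: "finite C \<Longrightarrow> card (edges C) = card C choose 2"
  unfolding edges_def by (simp add: n_subsets)

lemma edges_mono: "C \<subseteq> D \<Longrightarrow> edges C \<subseteq> edges D"
  unfolding edges_def by auto

lemma edges_Int: "edges (C \<inter> D) = edges C \<inter> edges D"
  unfolding edges_def by auto

definition likelihood :: "real \<Rightarrow> nat set \<Rightarrow> real \<Rightarrow> (nat set \<Rightarrow> real) \<Rightarrow> real" where
  "likelihood \<kappa> C \<Theta> X = (\<Prod>e\<in>edges C. vm_ratio \<kappa> \<Theta> (X e))"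

lemma likelihood_pos: "0 < likelihood \<kappa> C \<Theta> X"
  unfolding likelihood_def by (intro prod_pos) (simp add: vm_ratio_pos)

lemma prob_space_null_law: "prob_space (null_law n)"
  unfolding null_law_def by (intro prob_space_PiM prob_space_uniform_angle)

lemma measurable_null_law_component [measurable (raw)]:
  "e \<in> edges {1..n} \<Longrightarrow> (\<lambda>X. X e) \<in> borel_measurable (null_law n)"
  unfolding null_law_def
  by (rule measurable_compose[where g = "\<lambda>x. x", OF _ measurable_uniform_angle_ident])
     (rule measurable_component_singleton)

lemma measurable_likelihood:
  assumes C: "C \<subseteq> {1..n}"
    and f [measurable]: "f \<in> M \<rightarrow>\<^sub>M uniform_angle" and g: "g \<in> M \<rightarrow>\<^sub>M null_law n"
  shows "(\<lambda>x. likelihood \<kappa> C (f x) (g x)) \<in> borel_measurable M"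
  unfolding likelihood_def
proof (rule borel_measurable_prod)
  fix e assume "e \<in> edges C"
  then have "e \<in> edges {1..n}" using edges_mono[OF C] by auto
  then have [measurable]: "(\<lambda>x. g x e) \<in> borel_measurable M"
    by (intro measurable_compose[OF g measurable_null_law_component])
  have [measurable]: "f \<in> borel_measurable M"
    using measurable_compose[OF f measurable_uniform_angle_ident] .
  show "(\<lambda>x. vm_ratio \<kappa> (f x) (g x e)) \<in> borel_measurable M" by measurable
qed

lemma nn_integral_null_law_prod:
  assumes "\<And>e. e \<in> edges {1..n} \<Longrightarrow> f e \<in> borel_measurable uniform_angle"
  shows "(\<integral>\<^sup>+X. (\<Prod>e\<in>edges {1..n}. f e (X e)) \<partial>null_law n)
    = (\<Prod>e\<in>edges {1..n}. \<integral>\<^sup>+x. f e x \<partial>uniform_angle)"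
proof -
  interpret prob_space uniform_angle by (rule prob_space_uniform_angle)
  interpret product_sigma_finite "\<lambda>_::nat set. uniform_angle"
    by unfold_locales
  show ?thesis
    unfolding null_law_def
    by (rule product_nn_integral_prod) (use assms finite_edges in auto)
qed

lemma prod_edges_extend:
  fixes f :: "nat set \<Rightarrow> 'a :: comm_monoid_mult"
  assumes "C \<subseteq> {1..n}"
  shows "(\<Prod>e\<in>edges C. f e) = (\<Prod>e\<in>edges {1..n}. if e \<in> edges C then f e else 1)"
  using edges_mono[OF assms] finite_edges[of "{1..n}"]
  by (simp add: prod.If_cases Int_absorb1)

text \<open>The product measures agree on boxes: the integral of the product of the edge densities over a box
  factorises.\<close>
lemma community_law_eq_density:
  assumes C: "C \<subseteq> {1..n}" and \<Theta>: "0 \<le> \<Theta>" "\<Theta> \<le> 2 * pi"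
  shows "community_law n \<kappa> C \<Theta> = density (null_law n) (\<lambda>X. ennreal (likelihood \<kappa> C \<Theta> X))"
proof -
  define l where "l = (\<lambda>e x. if e \<in> edges C then ennreal (vm_ratio \<kappa> \<Theta> x) else 1)"
  have [measurable]: "l e \<in> borel_measurable uniform_angle" for e
    unfolding l_def by (cases "e \<in> edges C") auto
  let ?M = "\<lambda>e. if e \<in> edges C then von_mises \<Theta> \<kappa> else uniform_angle"
  have M: "?M e = density uniform_angle (l e)" for e
    by (auto simp: l_def von_mises_eq_density density_1)
  interpret U: prob_space uniform_angle by (rule prob_space_uniform_angle)
  have prob: "prob_space (?M e)" for e
    unfolding M
  proof (rule prob_spaceI)
    have "emeasure (density uniform_angle (l e)) (space uniform_angle) = (\<integral>\<^sup>+x. l e x \<partial>uniform_angle)"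
      by (subst emeasure_density) (auto intro!: nn_integral_cong)
    also have "\<dots> = 1"
      by (cases "e \<in> edges C") (simp_all add: l_def nn_integral_vm_ratio[OF \<Theta>] U.emeasure_space_1)
    finally show "emeasure (density uniform_angle (l e)) (space (density uniform_angle (l e))) = 1"
      by simp
  qed
  interpret M: product_sigma_finite ?M
    by (intro product_sigma_finite.intro prob_space_imp_sigma_finite prob)
  have like: "ennreal (likelihood \<kappa> C \<Theta> X) = (\<Prod>e\<in>edges {1..n}. l e (X e))" for X
  proof -
    have "ennreal (likelihood \<kappa> C \<Theta> X) = (\<Prod>e\<in>edges C. ennreal (vm_ratio \<kappa> \<Theta> (X e)))"
      unfolding likelihood_def by (rule prod_ennreal[symmetric]) (simp add: vm_ratio_pos less_imp_le)
    then show ?thesis unfolding prod_edges_extend[OF C] l_def by simp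
  qed
  have lm: "(\<lambda>X. ennreal (likelihood \<kappa> C \<Theta> X)) \<in> borel_measurable (null_law n)"
    unfolding like
  proof (rule borel_measurable_prod_ennreal)
    fix e assume "e \<in> edges {1..n}"
    then have "(\<lambda>X. X e) \<in> null_law n \<rightarrow>\<^sub>M uniform_angle"
      unfolding null_law_def by (rule measurable_component_singleton)
    then show "(\<lambda>X. l e (X e)) \<in> borel_measurable (null_law n)"
      by measurable
  qed
  have "density (null_law n) (\<lambda>X. ennreal (likelihood \<kappa> C \<Theta> X)) = PiM (edges {1..n}) ?M"
  proof (rule M.PiM_eqI)
    show "finite (edges {1..n})" by (simp add: finite_edges)
    show "sets (density (null_law n) (\<lambda>X. ennreal (likelihood \<kappa> C \<Theta> X))) = sets (PiM (edges {1..n}) ?M)"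
      unfolding null_law_def sets_density by (rule sets_PiM_cong) (auto simp: von_mises_eq_density)
    fix A assume "\<And>e. e \<in> edges {1..n} \<Longrightarrow> A e \<in> sets (?M e)"
    then have A [measurable]: "A e \<in> sets uniform_angle" if "e \<in> edges {1..n}" for e
      using that by (simp add: M)
    have PA: "Pi\<^sub>E (edges {1..n}) A \<in> sets (null_law n)"
      unfolding null_law_def using A finite_edges by (intro sets_PiM_I_finite) auto
    have "emeasure (density (null_law n) (\<lambda>X. ennreal (likelihood \<kappa> C \<Theta> X))) (Pi\<^sub>E (edges {1..n}) A)
        = (\<integral>\<^sup>+X. ennreal (likelihood \<kappa> C \<Theta> X) * indicator (Pi\<^sub>E (edges {1..n}) A) X \<partial>null_law n)"
      by (rule emeasure_density[OF lm PA])
    also have "\<dots> = (\<integral>\<^sup>+X. (\<Prod>e\<in>edges {1..n}. l e (X e) * indicator (A e) (X e)) \<partial>null_law n)"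
    proof (rule nn_integral_cong)
      fix X assume "X \<in> space (null_law n)"
      then have "indicator (Pi\<^sub>E (edges {1..n}) A) X = (\<Prod>e\<in>edges {1..n}. indicator (A e) (X e) :: ennreal)"
        using finite_edges[of "{1..n}"]
        by (auto simp: null_law_def space_PiM PiE_iff indicator_def prod_zero_iff split: if_splits)
      then show "ennreal (likelihood \<kappa> C \<Theta> X) * indicator (Pi\<^sub>E (edges {1..n}) A) X
          = (\<Prod>e\<in>edges {1..n}. l e (X e) * indicator (A e) (X e))"
        by (simp add: like prod.distrib)
    qed
    also have "\<dots> = (\<Prod>e\<in>edges {1..n}. \<integral>\<^sup>+x. l e x * indicator (A e) x \<partial>uniform_angle)"
      by (rule nn_integral_null_law_prod) (use A in measurable)
    also have "\<dots> = (\<Prod>e\<in>edges {1..n}. emeasure (?M e) (A e))"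
      unfolding M using A by (intro prod.cong refl) (simp add: emeasure_density)
    finally show "emeasure (density (null_law n) (\<lambda>X. ennreal (likelihood \<kappa> C \<Theta> X))) (Pi\<^sub>E (edges {1..n}) A)
        = (\<Prod>e\<in>edges {1..n}. emeasure (?M e) (A e))" .
  qed
  then show ?thesis unfolding community_law_def by simp
qed

lemma nn_integral_likelihood_powr:
  assumes C: "C \<subseteq> {1..n}" and \<Theta>: "0 \<le> \<Theta>" "\<Theta> \<le> 2 * pi"
  shows "(\<integral>\<^sup>+X. ennreal (likelihood \<kappa> C \<Theta> X powr p) \<partial>null_law n)
    = ennreal ((bessel_I0 (p * \<kappa>) / bessel_I0 \<kappa> powr p) ^ (card C choose 2))"
proof -
  have fin: "finite C" using C finite_subset by auto
  have "ennreal (likelihood \<kappa> C \<Theta> X powr p)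
      = (\<Prod>e\<in>edges {1..n}. if e \<in> edges C then ennreal (vm_ratio \<kappa> \<Theta> (X e) powr p) else 1)" for X
    unfolding likelihood_def prod_edges_extend[OF C, symmetric]
    by (subst prod_powr_distrib) (auto simp: vm_ratio_pos less_imp_le intro!: prod_ennreal[symmetric])
  then have "(\<integral>\<^sup>+X. ennreal (likelihood \<kappa> C \<Theta> X powr p) \<partial>null_law n)
      = (\<Prod>e\<in>edges {1..n}. \<integral>\<^sup>+x. (if e \<in> edges C then ennreal (vm_ratio \<kappa> \<Theta> x powr p) else 1) \<partial>uniform_angle)"
    by (simp only:, subst nn_integral_null_law_prod[symmetric]) auto
  also have "\<dots> = (\<Prod>e\<in>edges {1..n}. if e \<in> edges C
      then ennreal (bessel_I0 (p * \<kappa>) / bessel_I0 \<kappa> powr p) else 1)"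
    by (intro prod.cong refl)
       (simp add: nn_integral_vm_ratio_powr[OF \<Theta>] prob_space.emeasure_space_1[OF prob_space_uniform_angle])
  also have "\<dots> = (\<Prod>e\<in>edges C. ennreal (bessel_I0 (p * \<kappa>) / bessel_I0 \<kappa> powr p))"
    by (rule prod_edges_extend[OF C, symmetric])
  also have "\<dots> = ennreal ((bessel_I0 (p * \<kappa>) / bessel_I0 \<kappa> powr p) ^ (card C choose 2))"
    by (simp add: card_edges[OF fin] ennreal_power less_imp_le)
  finally show ?thesis .
qed

lemma nn_integral_likelihood:
  assumes C: "C \<subseteq> {1..n}" and \<Theta>: "0 \<le> \<Theta>" "\<Theta> \<le> 2 * pi"
  shows "(\<integral>\<^sup>+X. ennreal (likelihood \<kappa> C \<Theta> X) \<partial>null_law n) = 1"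
  using nn_integral_likelihood_powr[OF assms, of \<kappa> 1]
  by (simp add: likelihood_pos less_imp_le bessel_I0_pos[THEN less_imp_neq, symmetric])

lemma prod_mono_ennreal:
  fixes f g :: "'a \<Rightarrow> ennreal"
  shows "(\<And>x. x \<in> A \<Longrightarrow> f x \<le> g x) \<Longrightarrow> prod f A \<le> prod g A"
  by (induction A rule: infinite_finite_induct) (auto intro: mult_mono)

text \<open>Edges in just one of the two communities integrate to 1, since the density ratios do.\<close>
lemma nn_integral_likelihood_mult:
  assumes C: "C \<subseteq> {1..n}" and C': "C' \<subseteq> {1..n}"
    and \<Theta>: "0 \<le> \<Theta>" "\<Theta> \<le> 2 * pi" and \<Theta>': "0 \<le> \<Theta>'" "\<Theta>' \<le> 2 * pi"
  shows "(\<integral>\<^sup>+X. ennreal (likelihood \<kappa> C \<Theta> X * likelihood \<kappa> C' \<Theta>' X) \<partial>null_law n)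
    \<le> ennreal (bessel_ratio \<kappa> ^ (card (C \<inter> C') choose 2))"
proof -
  define f where "f = (\<lambda>e x. (if e \<in> edges C then ennreal (vm_ratio \<kappa> \<Theta> x) else 1)
    * (if e \<in> edges C' then ennreal (vm_ratio \<kappa> \<Theta>' x) else 1))"
  have fin: "finite (C \<inter> C')" using C finite_subset by auto
  have like: "ennreal (likelihood \<kappa> D t X)
      = (\<Prod>e\<in>edges {1..n}. if e \<in> edges D then ennreal (vm_ratio \<kappa> t (X e)) else 1)"
    if "D \<subseteq> {1..n}" for D t X
    unfolding likelihood_def prod_edges_extend[OF that, symmetric]
    by (rule prod_ennreal[symmetric]) (simp add: vm_ratio_pos less_imp_le)
  have "ennreal (likelihood \<kappa> C \<Theta> X * likelihood \<kappa> C' \<Theta>' X) = (\<Prod>e\<in>edges {1..n}. f e (X e))" for X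
    by (simp add: ennreal_mult likelihood_pos less_imp_le like[OF C] like[OF C'] prod.distrib f_def)
  moreover have "f e \<in> borel_measurable uniform_angle" for e
    unfolding f_def by (cases "e \<in> edges C"; cases "e \<in> edges C'") auto
  ultimately have "(\<integral>\<^sup>+X. ennreal (likelihood \<kappa> C \<Theta> X * likelihood \<kappa> C' \<Theta>' X) \<partial>null_law n)
      = (\<Prod>e\<in>edges {1..n}. \<integral>\<^sup>+x. f e x \<partial>uniform_angle)"
    by (simp only:, subst nn_integral_null_law_prod[symmetric]) auto
  also have "\<dots> \<le> (\<Prod>e\<in>edges {1..n}. if e \<in> edges (C \<inter> C') then ennreal (bessel_ratio \<kappa>) else 1)"
  proof (rule prod_mono_ennreal)
    fix e
    show "integral\<^sup>N uniform_angle (f e) \<le> (if e \<in> edges (C \<inter> C') then ennreal (bessel_ratio \<kappa>) else 1)"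
      by (cases "e \<in> edges C"; cases "e \<in> edges C'")
         (simp_all add: f_def edges_Int ennreal_mult[symmetric] vm_ratio_pos less_imp_le
           nn_integral_vm_ratio \<Theta> \<Theta>' nn_integral_vm_ratio_mult
           prob_space.emeasure_space_1[OF prob_space_uniform_angle])
  qed
  also have "\<dots> = (\<Prod>e\<in>edges (C \<inter> C'). ennreal (bessel_ratio \<kappa>))"
    by (rule prod_edges_extend[symmetric]) (use C in auto)
  also have "\<dots> = ennreal (bessel_ratio \<kappa> ^ (card (C \<inter> C') choose 2))"
    by (simp add: card_edges[OF fin] ennreal_power less_imp_le)
  finally show ?thesis .
qed

section \<open>The truncated second moment method\<close>

lemma Fubini_bounded:
  fixes f :: "'w \<Rightarrow> 'x \<Rightarrow> real"
  assumes W: "prob_space W" and Q: "prob_space Q"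
    and f: "(\<lambda>(w, x). f w x) \<in> borel_measurable (W \<Otimes>\<^sub>M Q)"
    and bd: "\<And>w x. w \<in> space W \<Longrightarrow> x \<in> space Q \<Longrightarrow> \<bar>f w x\<bar> \<le> b"
  shows "(\<integral>x. (\<integral>w. f w x \<partial>W) \<partial>Q) = (\<integral>w. (\<integral>x. f w x \<partial>Q) \<partial>W)"
proof -
  interpret W: prob_space W by fact
  interpret Q: prob_space Q by fact
  interpret P: pair_sigma_finite W Q ..
  interpret WQ: prob_space "W \<Otimes>\<^sub>M Q" by (rule prob_space_pair[OF W Q])
  have "integrable (W \<Otimes>\<^sub>M Q) (\<lambda>(w, x). f w x)"
    by (rule WQ.integrable_const_bound[where B = b, OF _ f]) (auto simp: space_pair_measure bd intro!: AE_I2)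
  then show ?thesis by (rule P.Fubini_integral)
qed

text \<open>Here \<open>G x\<close> is the mixture of the \<open>g w x\<close>. The left side is the integral over \<open>B\<close> of \<open>1 - G\<close>;
  Jensen's inequality bounds its square by the integral of
  \<open>(1 - G)^2 = 1 - 2 * G + G^2\<close>, and \<open>mass\<close> and \<open>corr\<close> control the integrals of
  \<open>G\<close> and \<open>G^2\<close>. The uniform bound \<open>T\<close> provides the integrability that
  Fubini's theorem asks for.\<close>
lemma truncated_second_moment:
  fixes g :: "'w \<Rightarrow> 'x \<Rightarrow> real"
  assumes W: "prob_space W" and Q: "prob_space Q"
    and g: "(\<lambda>(w, x). g w x) \<in> borel_measurable (W \<Otimes>\<^sub>M Q)"
    and bd: "\<And>w x. w \<in> space W \<Longrightarrow> x \<in> space Q \<Longrightarrow> 0 \<le> g w x \<and> g w x \<le> T"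
    and mass: "\<And>w. w \<in> space W \<Longrightarrow> 1 - \<eta> \<le> (\<integral>x. g w x \<partial>Q)"
    and corr: "\<And>w. w \<in> space W \<Longrightarrow> (\<integral>w'. (\<integral>x. g w x * g w' x \<partial>Q) \<partial>W) \<le> 1 + s"
    and B: "B \<in> sets Q"
  shows "measure Q B - (\<integral>w. (\<integral>x. indicator B x * g w x \<partial>Q) \<partial>W) \<le> sqrt (s + 2 * \<eta>)"
proof -
  interpret W: prob_space W by fact
  interpret Q: prob_space Q by fact
  interpret P: pair_sigma_finite W Q ..
  define G where "G = (\<lambda>x. \<integral>w. g w x \<partial>W)"
  have g1 [measurable]: "(\<lambda>w. g w x) \<in> borel_measurable W" if "x \<in> space Q" for x
    using measurable_compose[OF measurable_Pair2'[OF that] g] by simp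
  have g2 [measurable]: "(\<lambda>x. g w x) \<in> borel_measurable Q" if "w \<in> space W" for w
    using measurable_compose[OF measurable_Pair1'[OF that] g] by simp
  have G [measurable]: "G \<in> borel_measurable Q"
    unfolding G_def
    by (rule W.borel_measurable_lebesgue_integral) (use measurable_pair_swap[OF g] in simp)
  have int_g1: "integrable W (\<lambda>w. g w x)" if "x \<in> space Q" for x
    by (rule W.integrable_const_bound[where B = T]) (use bd that in \<open>auto intro!: AE_I2\<close>)
  have Gbd: "0 \<le> G x \<and> G x \<le> T" if "x \<in> space Q" for x
  proof
    show "0 \<le> G x" unfolding G_def using bd that by (intro integral_nonneg_AE AE_I2) auto
    show "G x \<le> T" unfolding G_def
      by (rule W.integral_le_const[OF int_g1[OF that]]) (use bd that in \<open>auto intro!: AE_I2\<close>)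
  qed
  have gabs: "\<bar>g w x\<bar> \<le> T" if "w \<in> space W" "x \<in> space Q" for w x using bd[OF that] by simp
  have Gabs: "\<bar>G x\<bar> \<le> T" if "x \<in> space Q" for x using Gbd[OF that] by simp
  have int: "integrable Q f" if "f \<in> borel_measurable Q" "\<And>x. x \<in> space Q \<Longrightarrow> \<bar>f x\<bar> \<le> b"
    for f :: "'x \<Rightarrow> real" and b
    by (rule Q.integrable_const_bound[where B = b]) (use that in \<open>auto intro!: AE_I2\<close>)
  have int_G: "integrable Q G" by (rule int[OF G Gabs])
  have GG: "\<bar>G x * G x\<bar> \<le> T * T" if "x \<in> space Q" for x
    unfolding abs_mult using Gabs[OF that] by (intro mult_mono) auto
  have int_GG: "integrable Q (\<lambda>x. G x * G x)" by (rule int[OF _ GG]) measurable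
  have gm: "(\<lambda>p. g (fst p) (snd p)) \<in> borel_measurable (W \<Otimes>\<^sub>M Q)"
    using g by (simp add: case_prod_beta)
  have "1 - \<eta> \<le> (\<integral>w. (\<integral>x. g w x \<partial>Q) \<partial>W)"
  proof -
    have "integrable W (\<lambda>w. \<integral>x. g w x \<partial>Q)"
    proof (rule W.integrable_const_bound[where B = T])
      show "(\<lambda>w. \<integral>x. g w x \<partial>Q) \<in> borel_measurable W"
        by (rule Q.borel_measurable_lebesgue_integral) (use g in simp)
      show "AE w in W. norm (\<integral>x. g w x \<partial>Q) \<le> T"
      proof (rule AE_I2)
        fix w assume w: "w \<in> space W"
        have "0 \<le> (\<integral>x. g w x \<partial>Q)" using bd w by (intro integral_nonneg_AE AE_I2) auto
        moreover have "(\<integral>x. g w x \<partial>Q) \<le> T"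
          by (rule Q.integral_le_const[OF int[OF g2[OF w] gabs[OF w]]]) (use bd w in \<open>auto intro!: AE_I2\<close>)
        ultimately show "norm (\<integral>x. g w x \<partial>Q) \<le> T" by simp
      qed
    qed
    then show ?thesis by (rule W.integral_ge_const) (use mass in \<open>auto intro!: AE_I2\<close>)
  qed
  also have "\<dots> = (\<integral>x. G x \<partial>Q)"
    unfolding G_def by (rule Fubini_bounded[OF W Q g gabs, symmetric])
  finally have EG: "1 - \<eta> \<le> (\<integral>x. G x \<partial>Q)" .
  have Gg: "\<bar>G x * g w x\<bar> \<le> T * T" if "w \<in> space W" "x \<in> space Q" for w x
    unfolding abs_mult using Gabs gabs that by (intro mult_mono) (auto intro: order_trans[OF abs_ge_zero])
  have inner: "(\<integral>x. G x * g w x \<partial>Q) = (\<integral>w'. (\<integral>x. g w x * g w' x \<partial>Q) \<partial>W)" if w: "w \<in> space W" for w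
  proof -
    have "(\<integral>x. G x * g w x \<partial>Q) = (\<integral>x. (\<integral>w'. g w x * g w' x \<partial>W) \<partial>Q)"
      unfolding G_def by (rule Bochner_Integration.integral_cong) (auto simp: mult.commute)
    also have "\<dots> = (\<integral>w'. (\<integral>x. g w x * g w' x \<partial>Q) \<partial>W)"
    proof (rule Fubini_bounded[OF W Q])
      have "(\<lambda>p. g w (snd p)) \<in> borel_measurable (W \<Otimes>\<^sub>M Q)"
        by (rule measurable_compose[OF measurable_snd g2[OF w]])
      then show "(\<lambda>(w', x). g w x * g w' x) \<in> borel_measurable (W \<Otimes>\<^sub>M Q)"
        using gm by (simp add: case_prod_beta)
      show "\<bar>g w x * g w' x\<bar> \<le> T * T" if "w' \<in> space W" "x \<in> space Q" for w' x
        unfolding abs_mult using gabs w that by (intro mult_mono) (auto intro: order_trans[OF abs_ge_zero])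
    qed
    finally show ?thesis .
  qed
  have Ggm: "(\<lambda>(w, x). G x * g w x) \<in> borel_measurable (W \<Otimes>\<^sub>M Q)"
    using measurable_compose[OF measurable_snd G, of W] gm by (simp add: case_prod_beta)
  have "(\<integral>x. G x * G x \<partial>Q) = (\<integral>x. (\<integral>w. G x * g w x \<partial>W) \<partial>Q)"
    by (rule Bochner_Integration.integral_cong) (auto simp: G_def)
  also have "\<dots> = (\<integral>w. (\<integral>x. G x * g w x \<partial>Q) \<partial>W)"
    by (rule Fubini_bounded[OF W Q Ggm Gg])
  also have "\<dots> \<le> 1 + s"
  proof (rule W.integral_le_const)
    show "integrable W (\<lambda>w. \<integral>x. G x * g w x \<partial>Q)"
    proof (rule W.integrable_const_bound[where B = "T * T"])
      show "(\<lambda>w. \<integral>x. G x * g w x \<partial>Q) \<in> borel_measurable W"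
        by (rule Q.borel_measurable_lebesgue_integral) (use Ggm in simp)
      show "AE w in W. norm (\<integral>x. G x * g w x \<partial>Q) \<le> T * T"
      proof (rule AE_I2)
        fix w assume w: "w \<in> space W"
        have i: "integrable Q (\<lambda>x. G x * g w x)" by (rule int[OF _ Gg[OF w]]) (use w in measurable)
        have "norm (\<integral>x. G x * g w x \<partial>Q) \<le> (\<integral>x. \<bar>G x * g w x\<bar> \<partial>Q)"
          using integral_norm_bound[of Q "\<lambda>x. G x * g w x"] by simp
        also have "\<dots> \<le> T * T"
          by (rule Q.integral_le_const[OF integrable_abs[OF i]]) (use Gg w in \<open>auto intro!: AE_I2\<close>)
        finally show "norm (\<integral>x. G x * g w x \<partial>Q) \<le> T * T" .
      qed
    qed
    show "AE w in W. (\<integral>x. G x * g w x \<partial>Q) \<le> 1 + s" using corr inner by (auto intro!: AE_I2)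
  qed
  finally have EGG: "(\<integral>x. G x * G x \<partial>Q) \<le> 1 + s" .
  define h where "h = (\<lambda>x. indicator B x * (1 - G x))"
  have [measurable]: "h \<in> borel_measurable Q" unfolding h_def using B by measurable
  have habs: "\<bar>h x\<bar> \<le> 1 + T" if "x \<in> space Q" for x
    using Gabs[OF that] Gbd[OF that] by (auto simp: h_def indicator_def)
  have int_h: "integrable Q h" by (rule int[OF _ habs]) measurable
  have hh: "\<bar>(h x)\<^sup>2\<bar> \<le> (1 + T)\<^sup>2" if "x \<in> space Q" for x
    using power_mono[OF habs[OF that], of 2] by simp
  have int_hh: "integrable Q (\<lambda>x. (h x)\<^sup>2)" by (rule int[OF _ hh]) measurable
  have "0 \<le> (\<integral>x. (h x)\<^sup>2 \<partial>Q) - (\<integral>x. h x \<partial>Q)\<^sup>2"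
    using Q.variance_positive[of h] unfolding Q.variance_eq[OF int_h int_hh] .
  then have "(\<integral>x. h x \<partial>Q)\<^sup>2 \<le> (\<integral>x. (h x)\<^sup>2 \<partial>Q)" by simp
  also have "\<dots> \<le> (\<integral>x. 1 - 2 * G x + G x * G x \<partial>Q)"
  proof (rule integral_mono[OF int_hh])
    show "integrable Q (\<lambda>x. 1 - 2 * G x + G x * G x)" using int_G int_GG by simp
    show "(h x)\<^sup>2 \<le> 1 - 2 * G x + G x * G x" for x
      using zero_le_power2[of "1 - G x"] by (auto simp: h_def indicator_def power2_eq_square algebra_simps)
  qed
  also have "\<dots> = 1 - 2 * (\<integral>x. G x \<partial>Q) + (\<integral>x. G x * G x \<partial>Q)"
    using int_G int_GG by (simp add: Q.prob_space)
  also have "\<dots> \<le> s + 2 * \<eta>" using EG EGG by simp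
  finally have "(\<integral>x. h x \<partial>Q) \<le> sqrt (s + 2 * \<eta>)" by (rule real_le_rsqrt)
  moreover have "(\<integral>x. h x \<partial>Q) = measure Q B - (\<integral>w. (\<integral>x. indicator B x * g w x \<partial>Q) \<partial>W)"
  proof -
    have iG: "integrable Q (\<lambda>x. indicator B x * G x)"
    proof (rule int)
      show "\<bar>indicator B x * G x\<bar> \<le> T" if "x \<in> space Q" for x
        using Gbd[OF that] by (auto simp: indicator_def)
    qed (use B in measurable)
    have "(\<integral>x. h x \<partial>Q) = (\<integral>x. indicator B x - indicator B x * G x \<partial>Q)"
      by (simp add: h_def algebra_simps)
    also have "\<dots> = measure Q B - (\<integral>x. indicator B x * G x \<partial>Q)"
      using iG B by (subst Bochner_Integration.integral_diff) (auto simp: Q.emeasure_eq_measure)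
    also have "(\<integral>x. indicator B x * G x \<partial>Q) = (\<integral>x. (\<integral>w. indicator B x * g w x \<partial>W) \<partial>Q)"
      by (rule Bochner_Integration.integral_cong) (auto simp: G_def)
    also have "\<dots> = (\<integral>w. (\<integral>x. indicator B x * g w x \<partial>Q) \<partial>W)"
    proof (rule Fubini_bounded[OF W Q])
      have "(\<lambda>p. indicator B (snd p) :: real) \<in> borel_measurable (W \<Otimes>\<^sub>M Q)" using B by measurable
      then show "(\<lambda>(w, x). indicator B x * g w x) \<in> borel_measurable (W \<Otimes>\<^sub>M Q)"
        using gm by (simp add: case_prod_beta)
      show "\<bar>indicator B x * g w x\<bar> \<le> T" if "w \<in> space W" "x \<in> space Q" for w x
        using bd[OF that] by (auto simp: indicator_def)
    qed
    finally show ?thesis .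
  qed
  ultimately show ?thesis by simp
qed

section \<open>The planted law and its truncated likelihood\<close>

text \<open>The kernel in \<open>planted_law\<close> has to be measurable at every set \<open>C\<close>, also outside the support of
  the prior; this reduces the question to subsets of \<open>{1..n}\<close>.\<close>
lemma community_law_restrict:
  "community_law n \<kappa> C \<Theta> = community_law n \<kappa> (C \<inter> {1..n}) \<Theta>"
  unfolding community_law_def by (rule PiM_cong) (auto simp: edges_def)

lemma sets_community_law:
  assumes "\<Theta> \<in> space uniform_angle"
  shows "sets (community_law n \<kappa> C \<Theta>) = sets (null_law n)"
  using assms community_law_eq_density[of "C \<inter> {1..n}" n \<Theta> \<kappa>]
  by (subst community_law_restrict) (simp add: space_uniform_angle)

lemma emeasure_community_law:
  assumes C: "C \<subseteq> {1..n}" and \<Theta>: "\<Theta> \<in> space uniform_angle" and A: "A \<in> sets (null_law n)"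
  shows "emeasure (community_law n \<kappa> C \<Theta>) A
    = (\<integral>\<^sup>+X. ennreal (indicator A X * likelihood \<kappa> C \<Theta> X) \<partial>null_law n)"
proof -
  have "(\<lambda>X. ennreal (likelihood \<kappa> C \<Theta> X)) \<in> borel_measurable (null_law n)"
    using measurable_likelihood[OF C, of "\<lambda>_. \<Theta>" "null_law n" "\<lambda>X. X" \<kappa>] \<Theta> by simp
  then have "emeasure (community_law n \<kappa> C \<Theta>) A
      = (\<integral>\<^sup>+X. ennreal (likelihood \<kappa> C \<Theta> X) * indicator A X \<partial>null_law n)"
    using \<Theta> A by (simp add: community_law_eq_density[OF C] space_uniform_angle emeasure_density)
  also have "\<dots> = (\<integral>\<^sup>+X. ennreal (indicator A X * likelihood \<kappa> C \<Theta> X) \<partial>null_law n)"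
    by (intro nn_integral_cong) (simp add: indicator_def)
  finally show ?thesis .
qed

lemma measurable_community_law:
  "community_law n \<kappa> C \<in> uniform_angle \<rightarrow>\<^sub>M subprob_algebra (null_law n)"
proof (rule measurable_subprob_algebra)
  let ?D = "C \<inter> {1..n}"
  have D: "?D \<subseteq> {1..n}" by auto
  fix \<Theta> assume \<Theta>: "\<Theta> \<in> space uniform_angle"
  then show "sets (community_law n \<kappa> C \<Theta>) = sets (null_law n)" by (rule sets_community_law)
  then have sp: "space (community_law n \<kappa> C \<Theta>) = space (null_law n)" by (rule sets_eq_imp_space_eq)
  have "emeasure (community_law n \<kappa> C \<Theta>) (space (null_law n)) = (\<integral>\<^sup>+X. ennreal (likelihood \<kappa> ?D \<Theta> X) \<partial>null_law n)"
    by (subst community_law_restrict, subst emeasure_community_law[OF D \<Theta>])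
       (auto intro!: nn_integral_cong)
  also have "\<dots> = 1" using \<Theta> by (intro nn_integral_likelihood[OF D]) (auto simp: space_uniform_angle)
  finally have "prob_space (community_law n \<kappa> C \<Theta>)" by (intro prob_spaceI) (simp add: sp)
  then show "subprob_space (community_law n \<kappa> C \<Theta>)" by (rule prob_space_imp_subprob_space)
next
  let ?D = "C \<inter> {1..n}"
  have D: "?D \<subseteq> {1..n}" by auto
  fix A assume A: "A \<in> sets (null_law n)"
  interpret Q: prob_space "null_law n" by (rule prob_space_null_law)
  have "(\<lambda>p. likelihood \<kappa> ?D (fst p) (snd p)) \<in> borel_measurable (uniform_angle \<Otimes>\<^sub>M null_law n)"
    by (rule measurable_likelihood[OF D measurable_fst measurable_snd])
  moreover have "(\<lambda>p. indicator A (snd p) :: real) \<in> borel_measurable (uniform_angle \<Otimes>\<^sub>M null_law n)"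
    using A by measurable
  ultimately have "(\<lambda>(\<Theta>, X). ennreal (indicator A X * likelihood \<kappa> ?D \<Theta> X))
      \<in> borel_measurable (uniform_angle \<Otimes>\<^sub>M null_law n)"
    by (simp add: case_prod_beta)
  then have "(\<lambda>\<Theta>. \<integral>\<^sup>+X. ennreal (indicator A X * likelihood \<kappa> ?D \<Theta> X) \<partial>null_law n) \<in> borel_measurable uniform_angle"
    by (rule Q.borel_measurable_nn_integral)
  then show "(\<lambda>\<Theta>. emeasure (community_law n \<kappa> C \<Theta>) A) \<in> borel_measurable uniform_angle"
    by (subst measurable_cong[OF trans[OF arg_cong[OF community_law_restrict,
      of "\<lambda>M. emeasure M A"] emeasure_community_law[OF D _ A]]]) auto
qed

lemma uniform_angle_nonempty: "space uniform_angle \<noteq> {}"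
  by (simp add: space_uniform_angle)

lemma measurable_mixed_community_law:
  "(\<lambda>C. uniform_angle \<bind> community_law n \<kappa> C) \<in> measure_pmf p \<rightarrow>\<^sub>M subprob_algebra (null_law n)"
  unfolding measurable_pmf_measure1
proof
  fix C
  have "subprob_space (uniform_angle \<bind> community_law n \<kappa> C)"
    by (rule subprob_space_bind[OF prob_space_imp_subprob_space[OF prob_space_uniform_angle]
          measurable_community_law])
  then show "uniform_angle \<bind> community_law n \<kappa> C \<in> space (subprob_algebra (null_law n))"
    using uniform_angle_nonempty sets_community_law
    by (simp add: space_subprob_algebra)
qed

lemma sets_planted_law: "sets (planted_law n k \<kappa>) = sets (null_law n)"
  unfolding planted_law_def
  by (rule sets_bind) (auto simp: uniform_angle_nonempty sets_community_law intro!: sets_bind)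

lemma subprob_space_planted_law: "subprob_space (planted_law n k \<kappa>)"
  unfolding planted_law_def
  by (rule subprob_space_bind[OF prob_space_imp_subprob_space[OF prob_space_measure_pmf]
        measurable_mixed_community_law])

lemma emeasure_planted_law:
  assumes A: "A \<in> sets (null_law n)" and k: "k \<le> n"
  shows "emeasure (planted_law n k \<kappa>) A
    = (\<Sum>C | C \<subseteq> {1..n} \<and> card C = k. \<integral>\<^sup>+\<Theta>. emeasure (community_law n \<kappa> C \<Theta>) A \<partial>uniform_angle) / (n choose k)"
proof -
  let ?\<C> = "{C. C \<subseteq> {1..n} \<and> card C = k}"
  have c: "card ?\<C> = n choose k" using n_subsets[of "{1..n}" k] by simp
  then have ne: "?\<C> \<noteq> {}" using k by (metis card.empty zero_less_binomial less_irrefl)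
  have fin: "finite ?\<C>" by simp
  have "emeasure (planted_law n k \<kappa>) A
      = (\<integral>\<^sup>+C. emeasure (uniform_angle \<bind> community_law n \<kappa> C) A \<partial>measure_pmf (pmf_of_set ?\<C>))"
    unfolding planted_law_def
    by (rule emeasure_bind[OF _ measurable_mixed_community_law A]) simp
  also have "\<dots> = (\<Sum>C\<in>?\<C>. emeasure (uniform_angle \<bind> community_law n \<kappa> C) A) / (n choose k)"
    using nn_integral_pmf_of_set[OF ne fin] c by simp
  also have "\<dots> = (\<Sum>C\<in>?\<C>. \<integral>\<^sup>+\<Theta>. emeasure (community_law n \<kappa> C \<Theta>) A \<partial>uniform_angle) / (n choose k)"
    by (simp only: emeasure_bind[OF uniform_angle_nonempty measurable_community_law A])
  finally show ?thesis .
qed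

text \<open>The prior of \<open>(C, \<Theta>)\<close> as a product measure. The first factor lives on the finite family of
  \<open>k\<close>-subsets instead of all sets of naturals, so that functions measurable in \<open>\<Theta>\<close> and the data for
  each fixed \<open>C\<close> are jointly measurable.\<close>
definition planted_prior :: "nat \<Rightarrow> nat \<Rightarrow> (nat set \<times> real) measure" where
  "planted_prior n k = uniform_count_measure {C. C \<subseteq> {1..n} \<and> card C = k} \<Otimes>\<^sub>M uniform_angle"

lemma prob_space_uniform_subsets:
  assumes "k \<le> n"
  shows "prob_space (uniform_count_measure {C. C \<subseteq> {1..n} \<and> card C = k})"
proof (rule prob_space_uniform_count_measure)
  have "card {C. C \<subseteq> {1..n} \<and> card C = k} = n choose k" using n_subsets[of "{1..n}" k] by simp
  then show "{C. C \<subseteq> {1..n} \<and> card C = k} \<noteq> {}"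
    using assms by (metis card.empty zero_less_binomial less_irrefl)
qed simp

lemma prob_space_planted_prior: "k \<le> n \<Longrightarrow> prob_space (planted_prior n k)"
  unfolding planted_prior_def
  by (intro prob_space_pair prob_space_uniform_subsets prob_space_uniform_angle)

lemma space_planted_prior:
  "space (planted_prior n k) = {C. C \<subseteq> {1..n} \<and> card C = k} \<times> {0..<2 * pi}"
  by (simp add: planted_prior_def space_pair_measure space_uniform_count_measure space_uniform_angle)

definition truncated_likelihood :: "real \<Rightarrow> real \<Rightarrow> nat set \<times> real \<Rightarrow> (nat set \<Rightarrow> real) \<Rightarrow> real" where
  "truncated_likelihood \<kappa> T w X = likelihood \<kappa> (fst w) (snd w) X * of_bool (likelihood \<kappa> (fst w) (snd w) X \<le> T)"

lemma truncated_likelihood_le: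
  "0 \<le> truncated_likelihood \<kappa> T w X"
  "truncated_likelihood \<kappa> T w X \<le> likelihood \<kappa> (fst w) (snd w) X"
  "0 \<le> T \<Longrightarrow> truncated_likelihood \<kappa> T w X \<le> T"
  by (auto simp: truncated_likelihood_def likelihood_pos less_imp_le)

lemma measurable_truncated_likelihood:
  "(\<lambda>(w, X). truncated_likelihood \<kappa> T w X) \<in> borel_measurable (planted_prior n k \<Otimes>\<^sub>M null_law n)"
proof -
  let ?\<C> = "{C. C \<subseteq> {1..n} \<and> card C = k}"
  let ?M = "planted_prior n k \<Otimes>\<^sub>M null_law n"
  have snd_m: "(\<lambda>p. snd (fst p)) \<in> ?M \<rightarrow>\<^sub>M uniform_angle"
    unfolding planted_prior_def by measurable
  have fst_m: "(\<lambda>p. fst (fst p)) \<in> ?M \<rightarrow>\<^sub>M count_space ?\<C>"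
    unfolding planted_prior_def
    by (subst measurable_cong_sets[OF refl sets_uniform_count_measure_count_space[symmetric]]) measurable
  have "(\<lambda>p. likelihood \<kappa> (fst (fst p)) (snd (fst p)) (snd p)) \<in> borel_measurable ?M"
    by (rule measurable_compose_countable'[OF _ fst_m,
        where f = "\<lambda>C p. likelihood \<kappa> C (snd (fst p)) (snd p)"])
       (auto intro!: measurable_likelihood[OF _ snd_m measurable_snd] countable_finite)
  then show ?thesis
    unfolding truncated_likelihood_def case_prod_beta by measurable
qed

lemma has_integral_likelihood_powr:
  assumes C: "C \<subseteq> {1..n}" and \<Theta>: "\<Theta> \<in> {0..<2 * pi}"
  shows "has_bochner_integral (null_law n) (\<lambda>X. likelihood \<kappa> C \<Theta> X powr p)
    ((bessel_I0 (p * \<kappa>) / bessel_I0 \<kappa> powr p) ^ (card C choose 2))"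
proof (rule has_bochner_integral_nn_integral)
  have [measurable]: "likelihood \<kappa> C \<Theta> \<in> borel_measurable (null_law n)"
    using measurable_likelihood[OF C, of "\<lambda>_. \<Theta>" "null_law n" "\<lambda>X. X" \<kappa>] \<Theta>
    by (simp add: space_uniform_angle)
  show "(\<lambda>X. likelihood \<kappa> C \<Theta> X powr p) \<in> borel_measurable (null_law n)" by measurable
  show "(\<integral>\<^sup>+X. ennreal (likelihood \<kappa> C \<Theta> X powr p) \<partial>null_law n)
    = ennreal ((bessel_I0 (p * \<kappa>) / bessel_I0 \<kappa> powr p) ^ (card C choose 2))"
    using \<Theta> by (intro nn_integral_likelihood_powr[OF C]) auto
qed (auto simp: less_imp_le)

lemma has_integral_likelihood:
  assumes C: "C \<subseteq> {1..n}" and \<Theta>: "\<Theta> \<in> {0..<2 * pi}"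
  shows "has_bochner_integral (null_law n) (likelihood \<kappa> C \<Theta>) 1"
  using has_integral_likelihood_powr[OF assms, of \<kappa> 1]
  by (simp add: likelihood_pos less_imp_le bessel_I0_pos[THEN less_imp_neq, symmetric])

lemma measurable_truncated_likelihood_section:
  assumes "w \<in> space (planted_prior n k)"
  shows "truncated_likelihood \<kappa> T w \<in> borel_measurable (null_law n)"
  using measurable_compose[OF measurable_Pair1'[OF assms] measurable_truncated_likelihood] by simp

text \<open>A bound on the planted probability of \<open>L > T\<close>: Markov's inequality for \<open>sqrt L\<close>, where the planted
  expectation of \<open>sqrt L\<close> is the null expectation of \<open>L powr (3 / 2)\<close>.\<close>
definition tail_mass :: "real \<Rightarrow> nat \<Rightarrow> real \<Rightarrow> real" where
  "tail_mass \<kappa> k T = (bessel_I0 (3 / 2 * \<kappa>) / bessel_I0 \<kappa> powr (3 / 2)) ^ (k choose 2) / sqrt T"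

lemma truncated_likelihood_mass:
  assumes w: "w \<in> space (planted_prior n k)" and T: "0 < T"
  shows "1 - tail_mass \<kappa> k T \<le> (\<integral>X. truncated_likelihood \<kappa> T w X \<partial>null_law n)"
proof -
  obtain C \<Theta> where [simp]: "w = (C, \<Theta>)" by (cases w)
  have C: "C \<subseteq> {1..n}" "card C = k" and \<Theta>: "\<Theta> \<in> {0..<2 * pi}"
    using w by (auto simp: space_planted_prior)
  interpret Q: prob_space "null_law n" by (rule prob_space_null_law)
  let ?L = "likelihood \<kappa> C \<Theta>"
  note L1 = has_integral_likelihood[OF C(1) \<Theta>, of \<kappa>]
  note L2 = has_integral_likelihood_powr[OF C(1) \<Theta>, of \<kappa> "3 / 2"]
  have iT: "integrable (null_law n) (truncated_likelihood \<kappa> T w)"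
    by (rule Q.integrable_const_bound[where B = T])
       (use T truncated_likelihood_le measurable_truncated_likelihood_section[OF w, of \<kappa> T] in
         \<open>auto intro!: AE_I2\<close>)
  have "1 - tail_mass \<kappa> k T = (\<integral>X. ?L X - ?L X powr (3 / 2) / sqrt T \<partial>null_law n)"
    unfolding tail_mass_def using L1 L2 C
    by (subst Bochner_Integration.integral_diff) (auto simp: has_bochner_integral_iff)
  also have "\<dots> \<le> (\<integral>X. truncated_likelihood \<kappa> T w X \<partial>null_law n)"
  proof (rule integral_mono)
    show "integrable (null_law n) (\<lambda>X. ?L X - ?L X powr (3 / 2) / sqrt T)"
      using L1 L2 by (auto simp: has_bochner_integral_iff)
    fix X
    show "?L X - ?L X powr (3 / 2) / sqrt T \<le> truncated_likelihood \<kappa> T w X"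
    proof (cases "?L X \<le> T")
      case True
      then show ?thesis using T by (simp add: truncated_likelihood_def)
    next
      case False
      have "?L X powr (3 / 2) = ?L X powr (1 + 1 / 2)" by simp
      also have "\<dots> = ?L X * sqrt (?L X)"
        unfolding powr_add using likelihood_pos[of \<kappa> C \<Theta> X] by (simp add: powr_half_sqrt)
      also have "\<dots> \<ge> ?L X * sqrt T"
        using False likelihood_pos[of \<kappa> C \<Theta> X] by (intro mult_left_mono) auto
      finally have "?L X \<le> ?L X powr (3 / 2) / sqrt T" using T by (simp add: field_simps)
      then show ?thesis using False by (simp add: truncated_likelihood_def)
    qed
  qed (rule iT)
  finally show ?thesis .
qed

text \<open>Two competing bounds: drop both truncations and use the correlation of the densities, or bound one
  factor by \<open>T\<close> and integrate the other to at most 1.\<close>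
lemma truncated_likelihood_pair:
  assumes w: "w \<in> space (planted_prior n k)" and w': "w' \<in> space (planted_prior n k)" and T: "0 < T"
  shows "(\<integral>X. truncated_likelihood \<kappa> T w X * truncated_likelihood \<kappa> T w' X \<partial>null_law n)
    \<le> min (bessel_ratio \<kappa> ^ (card (fst w' \<inter> fst w) choose 2)) T"
proof -
  obtain C \<Theta> C' \<Theta>' where [simp]: "w = (C, \<Theta>)" "w' = (C', \<Theta>')" by (cases w; cases w')
  have C: "C \<subseteq> {1..n}" "C' \<subseteq> {1..n}" and \<Theta>: "\<Theta> \<in> {0..<2 * pi}" "\<Theta>' \<in> {0..<2 * pi}"
    using w w' by (auto simp: space_planted_prior)
  interpret Q: prob_space "null_law n" by (rule prob_space_null_law)
  let ?g = "truncated_likelihood \<kappa> T"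
  have m [measurable]: "?g w \<in> borel_measurable (null_law n)" "?g w' \<in> borel_measurable (null_law n)"
    using w w' by (auto intro: measurable_truncated_likelihood_section)
  have i: "integrable (null_law n) (\<lambda>X. ?g w X * ?g w' X)"
  proof (rule Q.integrable_const_bound[where B = "T * T"])
    show "AE X in null_law n. norm (?g w X * ?g w' X) \<le> T * T"
      using T truncated_likelihood_le by (intro AE_I2) (auto simp: abs_mult intro!: mult_mono)
  qed measurable
  have "ennreal (\<integral>X. ?g w X * ?g w' X \<partial>null_law n) = (\<integral>\<^sup>+X. ennreal (?g w X * ?g w' X) \<partial>null_law n)"
    using truncated_likelihood_le(1) by (intro nn_integral_eq_integral[OF i, symmetric] AE_I2) auto
  also have "\<dots> \<le> (\<integral>\<^sup>+X. ennreal (likelihood \<kappa> C \<Theta> X * likelihood \<kappa> C' \<Theta>' X) \<partial>null_law n)"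
    using truncated_likelihood_le(1,2)[of \<kappa> T "(C, \<Theta>)"] truncated_likelihood_le(1,2)[of \<kappa> T "(C', \<Theta>')"]
    by (intro nn_integral_mono ennreal_leI mult_mono) (auto simp: likelihood_pos less_imp_le)
  also have "\<dots> \<le> ennreal (bessel_ratio \<kappa> ^ (card (C \<inter> C') choose 2))"
    using \<Theta> by (intro nn_integral_likelihood_mult[OF C]) auto
  finally have "(\<integral>X. ?g w X * ?g w' X \<partial>null_law n) \<le> bessel_ratio \<kappa> ^ (card (C \<inter> C') choose 2)"
    by (simp add: less_imp_le)
  moreover have "(\<integral>X. ?g w X * ?g w' X \<partial>null_law n) \<le> T"
  proof -
    have "(\<integral>X. ?g w X * ?g w' X \<partial>null_law n) \<le> (\<integral>X. T * likelihood \<kappa> C' \<Theta>' X \<partial>null_law n)"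
    using has_integral_likelihood[OF C(2) \<Theta>(2), of \<kappa>] T truncated_likelihood_le[of T \<kappa> w]
      truncated_likelihood_le[of T \<kappa> w'] truncated_likelihood_le
    by (intro integral_mono[OF i] mult_mono)
       (auto simp: has_bochner_integral_iff likelihood_pos less_imp_le
         intro: order_trans[OF truncated_likelihood_le(2)])
    also have "\<dots> = T"
      using has_integral_likelihood[OF C(2) \<Theta>(2), of \<kappa>] by (simp add: has_bochner_integral_iff)
    finally show ?thesis .
  qed
  ultimately show ?thesis by (simp add: Int_commute)
qed

lemma truncated_likelihood_corr:
  assumes w: "w \<in> space (planted_prior n k)" and k: "k \<le> n" "0 < n" and T: "0 < T"
  shows "(\<integral>w'. (\<integral>X. truncated_likelihood \<kappa> T w X * truncated_likelihood \<kappa> T w' X \<partial>null_law n) \<partial>planted_prior n k)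
    \<le> 1 + (\<Sum>m=2..k. ((real k)\<^sup>2 / real n) ^ m * min (bessel_ratio \<kappa> ^ (m choose 2)) T)"
proof -
  let ?\<C> = "{C. C \<subseteq> {1..n} \<and> card C = k}"
  let ?g = "truncated_likelihood \<kappa> T"
  let ?B = "\<lambda>m. min (bessel_ratio \<kappa> ^ (m choose 2)) T"
  define F where "F = (\<lambda>C'. ?B (card (C' \<inter> fst w)))"
  have C: "fst w \<subseteq> {1..n}" "card (fst w) = k" using w by (auto simp: space_planted_prior)
  interpret W: prob_space "planted_prior n k" by (rule prob_space_planted_prior[OF k(1)])
  interpret Q: prob_space "null_law n" by (rule prob_space_null_law)
  interpret S: prob_space "uniform_count_measure ?\<C>" by (rule prob_space_uniform_subsets[OF k(1)])
  interpret U: prob_space uniform_angle by (rule prob_space_uniform_angle)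
  interpret SU: pair_sigma_finite "uniform_count_measure ?\<C>" uniform_angle ..
  have Fbd: "\<bar>F C'\<bar> \<le> T" for C' using T by (auto simp: F_def less_imp_le min_def)
  have Fm: "(\<lambda>w'. F (fst w')) \<in> borel_measurable (planted_prior n k)"
    unfolding planted_prior_def
    by (rule measurable_compose[OF measurable_fst])
       (simp add: measurable_cong_sets[OF sets_uniform_count_measure_count_space refl])
  have iF: "integrable (planted_prior n k) (\<lambda>w'. F (fst w'))"
    by (rule W.integrable_const_bound[where B = T, OF _ Fm]) (use Fbd in auto)
  have "(\<integral>w'. (\<integral>X. ?g w X * ?g w' X \<partial>null_law n) \<partial>planted_prior n k) \<le> (\<integral>w'. F (fst w') \<partial>planted_prior n k)"
    by (rule integral_mono'[OF iF])
       (use truncated_likelihood_pair[OF w] T in \<open>auto simp: F_def less_imp_le\<close>)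
  also have "\<dots> = (\<integral>C'. (\<integral>\<Theta>. F C' \<partial>uniform_angle) \<partial>uniform_count_measure ?\<C>)"
    using SU.integral_fst'[of "\<lambda>w'. F (fst w')"] iF unfolding planted_prior_def by simp
  also have "\<dots> = (\<Sum>C'\<in>?\<C>. F C') / real (n choose k)"
    using n_subsets[of "{1..n}" k] by (simp add: U.prob_space integral_uniform_count_measure)
  also have "\<dots> \<le> 1 + (\<Sum>m=2..k. ((real k)\<^sup>2 / real n) ^ m * ?B m)"
    unfolding F_def
    by (rule average_overlap_le) (use C k T in \<open>auto simp: less_imp_le binomial_eq_0\<close>)
  finally show ?thesis .
qed

text \<open>Truncation loses mass, so the truncated mixture is a lower bound for the planted law.\<close>
lemma truncated_likelihood_le_planted_law:
  assumes A: "A \<in> sets (null_law n)" and k: "k \<le> n" and T: "0 < T"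
  shows "(\<integral>w. (\<integral>X. indicator A X * truncated_likelihood \<kappa> T w X \<partial>null_law n) \<partial>planted_prior n k)
    \<le> measure (planted_law n k \<kappa>) A"
proof -
  let ?\<C> = "{C. C \<subseteq> {1..n} \<and> card C = k}"
  let ?f = "\<lambda>w X. indicator A X * truncated_likelihood \<kappa> T w X"
  interpret W: prob_space "planted_prior n k" by (rule prob_space_planted_prior[OF k])
  interpret Q: prob_space "null_law n" by (rule prob_space_null_law)
  interpret S: prob_space "uniform_count_measure ?\<C>" by (rule prob_space_uniform_subsets[OF k])
  interpret U: prob_space uniform_angle by (rule prob_space_uniform_angle)
  interpret SU: pair_sigma_finite "uniform_count_measure ?\<C>" uniform_angle ..
  interpret P: subprob_space "planted_law n k \<kappa>" by (rule subprob_space_planted_law)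
  have c: "card ?\<C> = n choose k" using n_subsets[of "{1..n}" k] by simp
  have inv_c: "ennreal (1 / real (n choose k)) = inverse (of_nat (n choose k))"
    using k by (simp add: inverse_ennreal[symmetric] divide_inverse ennreal_of_nat_eq_real_of_nat)
  have fbd: "0 \<le> ?f w X \<and> ?f w X \<le> T" for w X
    using truncated_likelihood_le[of T \<kappa> w X] truncated_likelihood_le(1)[of \<kappa> T w X] T
    by (auto simp: indicator_def)
  have "(\<lambda>p. indicator A (snd p) :: real) \<in> borel_measurable (planted_prior n k \<Otimes>\<^sub>M null_law n)"
    using A by measurable
  then have fm: "(\<lambda>(w, X). ?f w X) \<in> borel_measurable (planted_prior n k \<Otimes>\<^sub>M null_law n)"
    using measurable_truncated_likelihood[of \<kappa> T n k] by (simp add: case_prod_beta)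
  have fi: "integrable (null_law n) (?f w)" if "w \<in> space (planted_prior n k)" for w
    by (rule Q.integrable_const_bound[where B = T])
       (use fbd A measurable_truncated_likelihood_section[OF that, of \<kappa> T] in \<open>auto intro!: AE_I2\<close>)
  have Fm: "(\<lambda>w. \<integral>X. ?f w X \<partial>null_law n) \<in> borel_measurable (planted_prior n k)"
    by (rule Q.borel_measurable_lebesgue_integral) (rule fm)
  have Fbd: "0 \<le> (\<integral>X. ?f w X \<partial>null_law n) \<and> (\<integral>X. ?f w X \<partial>null_law n) \<le> T"
    if "w \<in> space (planted_prior n k)" for w
  proof
    show "0 \<le> (\<integral>X. ?f w X \<partial>null_law n)" using fbd by (intro integral_nonneg_AE AE_I2) blast
    show "(\<integral>X. ?f w X \<partial>null_law n) \<le> T"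
      by (rule Q.integral_le_const[OF fi[OF that]]) (use fbd in \<open>auto intro!: AE_I2\<close>)
  qed
  have Fi: "integrable (planted_prior n k) (\<lambda>w. \<integral>X. ?f w X \<partial>null_law n)"
    by (rule W.integrable_const_bound[where B = T, OF _ Fm]) (use Fbd in \<open>auto intro!: AE_I2\<close>)
  have nm: "(\<lambda>w. \<integral>\<^sup>+X. ennreal (?f w X) \<partial>null_law n) \<in> borel_measurable (planted_prior n k)"
    by (rule Q.borel_measurable_nn_integral) (use fm in \<open>simp add: case_prod_beta\<close>)
  have "ennreal (\<integral>w. (\<integral>X. ?f w X \<partial>null_law n) \<partial>planted_prior n k)
      = (\<integral>\<^sup>+w. ennreal (\<integral>X. ?f w X \<partial>null_law n) \<partial>planted_prior n k)"
    by (rule nn_integral_eq_integral[OF Fi, symmetric]) (use Fbd in \<open>auto intro!: AE_I2\<close>)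
  also have "\<dots> = (\<integral>\<^sup>+w. (\<integral>\<^sup>+X. ennreal (?f w X) \<partial>null_law n) \<partial>planted_prior n k)"
    by (rule nn_integral_cong, rule nn_integral_eq_integral[OF fi, symmetric])
       (use fbd in \<open>auto intro!: AE_I2\<close>)
  also have "\<dots> = (\<integral>\<^sup>+C. (\<integral>\<^sup>+\<Theta>. (\<integral>\<^sup>+X. ennreal (?f (C, \<Theta>) X) \<partial>null_law n) \<partial>uniform_angle) \<partial>uniform_count_measure ?\<C>)"
    using U.nn_integral_fst[OF nm[unfolded planted_prior_def]] unfolding planted_prior_def by simp
  also have "\<dots> \<le> (\<integral>\<^sup>+C. (\<integral>\<^sup>+\<Theta>. emeasure (community_law n \<kappa> C \<Theta>) A \<partial>uniform_angle) \<partial>uniform_count_measure ?\<C>)"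
  proof (intro nn_integral_mono)
    fix C \<Theta> assume "C \<in> space (uniform_count_measure ?\<C>)" and \<Theta>: "\<Theta> \<in> space uniform_angle"
    then have C: "C \<subseteq> {1..n}" by (simp add: space_uniform_count_measure)
    show "(\<integral>\<^sup>+X. ennreal (?f (C, \<Theta>) X) \<partial>null_law n) \<le> emeasure (community_law n \<kappa> C \<Theta>) A"
      unfolding emeasure_community_law[OF C \<Theta> A]
      using truncated_likelihood_le(2)[of \<kappa> T "(C, \<Theta>)"]
      by (intro nn_integral_mono ennreal_leI mult_left_mono) auto
  qed
  also have "\<dots> = emeasure (planted_law n k \<kappa>) A"
    unfolding emeasure_planted_law[OF A k] uniform_count_measure_def
    using inv_c by (subst nn_integral_point_measure_finite, simp)
      (simp only: c divide_ennreal_def sum_distrib_left[symmetric] mult.commute)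
  also have "\<dots> = ennreal (measure (planted_law n k \<kappa>) A)" by (rule P.emeasure_eq_measure)
  finally show ?thesis by simp
qed

text \<open>With \<open>A\<close> the event of accepting, \<open>p_fa + p_miss\<close> is \<open>1 - (Q A - P A)\<close>, and the truncated mixture
  is below \<open>P\<close>.\<close>
lemma testing_bound:
  assumes k: "k \<le> n" "0 < n" and T: "0 < T" and \<phi>: "\<phi> \<in> null_law n \<rightarrow>\<^sub>M count_space {0, 1}"
  shows "1 - sqrt ((\<Sum>m=2..k. ((real k)\<^sup>2 / real n) ^ m * min (bessel_ratio \<kappa> ^ (m choose 2)) T)
      + 2 * tail_mass \<kappa> k T)
    \<le> p_fa (null_law n) \<phi> + p_miss (planted_law n k \<kappa>) \<phi>"
proof -
  interpret Q: prob_space "null_law n" by (rule prob_space_null_law)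
  let ?A = "{X \<in> space (null_law n). \<phi> X = 0}"
  have A: "?A \<in> sets (null_law n)"
    using measurable_sets[OF \<phi>, of "{0}"] by (auto simp: vimage_def Int_def conj_commute)
  have "{X \<in> space (null_law n). \<phi> X = 1} = space (null_law n) - ?A"
    using measurable_space[OF \<phi>] by fastforce
  then have fa: "p_fa (null_law n) \<phi> = 1 - measure (null_law n) ?A"
    unfolding p_fa_def using Q.prob_compl[OF A] by simp
  have miss: "p_miss (planted_law n k \<kappa>) \<phi> = measure (planted_law n k \<kappa>) ?A"
    unfolding p_miss_def by (simp add: sets_eq_imp_space_eq[OF sets_planted_law])
  have "measure (null_law n) ?A
      - (\<integral>w. (\<integral>X. indicator ?A X * truncated_likelihood \<kappa> T w X \<partial>null_law n) \<partial>planted_prior n k)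
    \<le> sqrt ((\<Sum>m=2..k. ((real k)\<^sup>2 / real n) ^ m * min (bessel_ratio \<kappa> ^ (m choose 2)) T)
      + 2 * tail_mass \<kappa> k T)"
    by (rule truncated_second_moment[where T = T, OF prob_space_planted_prior[OF k(1)] prob_space_null_law
          measurable_truncated_likelihood _ truncated_likelihood_mass[OF _ T]
          truncated_likelihood_corr[OF _ k T] A])
       (use T truncated_likelihood_le in auto)
  then show ?thesis
    using truncated_likelihood_le_planted_law[OF A k(1) T, of \<kappa>] unfolding fa miss by linarith
qed

section \<open>Reduction to bounds on the overlap terms\<close>

text \<open>The error sequence in the definition has to work for every \<open>n\<close>; the finitely many \<open>n\<close> without a bound
  get the trivial error 1.\<close>
lemma weak_detection_impossibleI:
  fixes Q P :: "nat \<Rightarrow> 'a measure"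
  assumes s: "s \<longlonglongrightarrow> 0"
    and ev: "\<forall>\<^sub>F n in sequentially. \<forall>\<phi>. \<phi> \<in> Q n \<rightarrow>\<^sub>M count_space {0, 1} \<longrightarrow>
      1 - s n \<le> p_fa (Q n) \<phi> + p_miss (P n) \<phi>"
  shows "weak_detection_impossible Q P"
  unfolding weak_detection_impossible_def
proof (intro allI impI)
  fix \<phi> :: "nat \<Rightarrow> 'a \<Rightarrow> nat" assume \<phi>: "\<forall>n. \<phi> n \<in> Q n \<rightarrow>\<^sub>M count_space {0, 1}"
  obtain N where N: "\<And>n \<phi>. n \<ge> N \<Longrightarrow> \<phi> \<in> Q n \<rightarrow>\<^sub>M count_space {0, 1} \<Longrightarrow>
      1 - s n \<le> p_fa (Q n) \<phi> + p_miss (P n) \<phi>"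
    using ev unfolding eventually_sequentially by blast
  let ?r = "\<lambda>n. if n \<ge> N then s n else 1"
  have "\<forall>\<^sub>F n in sequentially. s n = ?r n"
    using eventually_ge_at_top[of N] by eventually_elim simp
  then have "?r \<longlonglongrightarrow> 0" using s by (rule Lim_transform_eventually[rotated])
  moreover have "1 - ?r n \<le> p_fa (Q n) (\<phi> n) + p_miss (P n) (\<phi> n)" for n
    using N[of n "\<phi> n"] \<phi> by (auto simp: p_fa_def p_miss_def)
  ultimately show "\<exists>r. r \<longlonglongrightarrow> 0 \<and> (\<forall>n. p_fa (Q n) (\<phi> n) + p_miss (P n) (\<phi> n) \<ge> 1 - r n)"
    by blast
qed

lemma geometric_tail_le:
  fixes q :: real
  assumes "0 \<le> q" "q \<le> 1 / 2"
  shows "(\<Sum>m=2..k. q ^ m) \<le> q"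
proof -
  have "(\<Sum>m=2..k. q ^ m) \<le> 2 * q\<^sup>2 - 2 * q ^ Suc k" if "1 \<le> k" for k
    using that
  proof (induction k rule: dec_induct)
    case (step k)
    have "2 * q * q ^ Suc k \<le> 1 * q ^ Suc k" using assms by (intro mult_right_mono) auto
    then show ?case using step by simp
  qed (simp add: power2_eq_square)
  moreover have "2 * q\<^sup>2 \<le> q"
    using mult_right_mono[of "2 * q" 1 q] assms by (simp add: power2_eq_square)
  moreover have "0 \<le> q ^ Suc k" using assms by simp
  ultimately show ?thesis
  proof (cases "1 \<le> k")
    case True
    then have "(\<Sum>m=2..k. q ^ m) \<le> 2 * q\<^sup>2 - 2 * q ^ Suc k" by fact
    with \<open>2 * q\<^sup>2 \<le> q\<close> \<open>0 \<le> q ^ Suc k\<close> show ?thesis by linarith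
  qed (use assms in simp)
qed

lemma tail_mass_small:
  assumes "0 < h"
  shows "\<exists>T>0. tail_mass \<kappa> k T \<le> h"
proof -
  let ?a = "(bessel_I0 (3 / 2 * \<kappa>) / bessel_I0 \<kappa> powr (3 / 2)) ^ (k choose 2)"
  let ?T = "(?a / h)\<^sup>2"
  have a: "0 < ?a" by (intro zero_less_power divide_pos_pos) auto
  have "sqrt ?T = ?a / h"
    by (simp only: real_sqrt_abs abs_of_pos[OF divide_pos_pos[OF a assms]])
  then have "?a / sqrt ?T \<le> h" using a by (simp only:) simp
  moreover have "0 < ?T" by (intro zero_less_power divide_pos_pos a assms)
  ultimately show ?thesis unfolding tail_mass_def by blast
qed

text \<open>The threshold \<open>T\<close> may be chosen separately for each \<open>n\<close>. The geometric sum starts at \<open>m = 2\<close>, so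
  it is at most \<open>2 * q^2\<close>, and hence at most \<open>q\<close> once \<open>q \<le> 1 / 2\<close>.\<close>
lemma impossible_from_moments:
  assumes k: "\<forall>\<^sub>F n in sequentially. k n \<le> n"
    and q: "q \<longlonglongrightarrow> 0" "\<forall>\<^sub>F n in sequentially. 0 \<le> q n" and h: "h \<longlonglongrightarrow> 0"
    and ev: "\<forall>\<^sub>F n in sequentially. \<exists>T>0. tail_mass (\<kappa> n) (k n) T \<le> h n \<and>
      (\<forall>m\<in>{2..k n}. ((real (k n))\<^sup>2 / real n) ^ m * min (bessel_ratio (\<kappa> n) ^ (m choose 2)) T \<le> q n ^ m)"
  shows "weak_detection_impossible null_law (\<lambda>n. planted_law n (k n) (\<kappa> n))"
proof (rule weak_detection_impossibleI)
  have "(\<lambda>n. sqrt (q n + 2 * h n)) \<longlonglongrightarrow> sqrt (0 + 2 * 0)"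
    by (intro tendsto_intros q h)
  then show "(\<lambda>n. sqrt (q n + 2 * h n)) \<longlonglongrightarrow> 0" by simp
  have "\<forall>\<^sub>F n in sequentially. q n < 1 / 2" using q(1) by (rule order_tendstoD) simp
  then show "\<forall>\<^sub>F n in sequentially. \<forall>\<phi>. \<phi> \<in> null_law n \<rightarrow>\<^sub>M count_space {0, 1} \<longrightarrow>
      1 - sqrt (q n + 2 * h n) \<le> p_fa (null_law n) \<phi> + p_miss (planted_law n (k n) (\<kappa> n)) \<phi>"
    using k q(2) ev eventually_gt_at_top[of 0]
  proof eventually_elim
    case (elim n)
    then obtain T where T: "0 < T" "tail_mass (\<kappa> n) (k n) T \<le> h n"
      "\<And>m. m \<in> {2..k n} \<Longrightarrow>
        ((real (k n))\<^sup>2 / real n) ^ m * min (bessel_ratio (\<kappa> n) ^ (m choose 2)) T \<le> q n ^ m"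
      by blast
    have "(\<Sum>m=2..k n. ((real (k n))\<^sup>2 / real n) ^ m * min (bessel_ratio (\<kappa> n) ^ (m choose 2)) T)
        \<le> (\<Sum>m=2..k n. q n ^ m)"
      by (rule sum_mono) (rule T(3))
    also have "\<dots> \<le> q n" using elim by (intro geometric_tail_le) auto
    finally have le: "sqrt ((\<Sum>m=2..k n. ((real (k n))\<^sup>2 / real n) ^ m * min (bessel_ratio (\<kappa> n) ^ (m choose 2)) T)
        + 2 * tail_mass (\<kappa> n) (k n) T) \<le> sqrt (q n + 2 * h n)"
      using T(2) by simp
    show ?case
    proof (intro allI impI)
      fix \<phi> :: "(nat set \<Rightarrow> real) \<Rightarrow> nat" assume \<phi>: "\<phi> \<in> null_law n \<rightarrow>\<^sub>M count_space {0, 1}"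
      show "1 - sqrt (q n + 2 * h n) \<le> p_fa (null_law n) \<phi> + p_miss (planted_law n (k n) (\<kappa> n)) \<phi>"
        by (rule order_trans[OF diff_left_mono[OF le]
              testing_bound[OF elim(2) elim(5) T(1) \<phi>]])
    qed
  qed
qed

lemma real_choose_two: "real (m choose 2) = real m * (real m - 1) / 2"
  unfolding choose_two by (subst real_of_nat_div) (cases m; simp add: algebra_simps)+

lemma power_choose_two:
  assumes "0 < (a :: real)"
  shows "a ^ (m choose 2) = exp (ln a * (real m * (real m - 1) / 2))"
  using exp_of_nat_mult[of "m choose 2" "ln a"] assms
  by (simp add: real_choose_two[symmetric] mult.commute)

text \<open>As \<open>b ^ (m choose 2)\<close> is \<open>exp (ln b * (m - 1) / 2) ^ m\<close>, each of the \<open>m\<close> factors \<open>x\<close> has to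
  compensate only \<open>exp (ln b * (m - 1) / 2)\<close>.\<close>
lemma overlap_term_le:
  assumes x: "0 \<le> x" and b: "0 < b"
    and c: "ln b * (real m - 1) / 2 \<le> c" and q: "x * exp c \<le> q"
  shows "x ^ m * b ^ (m choose 2) \<le> q ^ m"
proof -
  have "x ^ m * b ^ (m choose 2) = x ^ m * exp (real m * (ln b * (real m - 1) / 2))"
    by (simp add: power_choose_two[OF b] algebra_simps)
  also have "\<dots> \<le> x ^ m * exp (real m * c)"
  proof (rule mult_left_mono)
    have "real m * (ln b * (real m - 1) / 2) \<le> real m * c" using c by (rule mult_left_mono) simp
    then show "exp (real m * (ln b * (real m - 1) / 2)) \<le> exp (real m * c)" by (subst exp_le_cancel_iff)
  qed (use x in simp)
  also have "\<dots> = (x * exp c) ^ m" by (simp add: power_mult_distrib exp_of_nat_mult)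
  also have "\<dots> \<le> q ^ m" using x q by (intro power_mono) auto
  finally show ?thesis .
qed

text \<open>If the summands are small without the minimum, \<open>T\<close> only needs to be large enough to make the tail
  mass negligible.\<close>
lemma impossible_untruncated:
  assumes k: "\<forall>\<^sub>F n in sequentially. k n \<le> n"
    and q: "q \<longlonglongrightarrow> 0" "\<forall>\<^sub>F n in sequentially. 0 \<le> q n"
    and ev: "\<forall>\<^sub>F n in sequentially. \<forall>m\<in>{2..k n}. \<exists>c.
      ln (bessel_ratio (\<kappa> n)) * (real m - 1) / 2 \<le> c \<and> (real (k n))\<^sup>2 / real n * exp c \<le> q n"
  shows "weak_detection_impossible null_law (\<lambda>n. planted_law n (k n) (\<kappa> n))"
proof (rule impossible_from_moments[OF k q])
  show "(\<lambda>n. 1 / real n) \<longlonglongrightarrow> 0" by real_asymp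
  show "\<forall>\<^sub>F n in sequentially. \<exists>T>0. tail_mass (\<kappa> n) (k n) T \<le> 1 / real n \<and>
      (\<forall>m\<in>{2..k n}. ((real (k n))\<^sup>2 / real n) ^ m * min (bessel_ratio (\<kappa> n) ^ (m choose 2)) T \<le> q n ^ m)"
    using ev eventually_gt_at_top[of 0]
  proof eventually_elim
    case (elim n)
    obtain T where T: "0 < T" "tail_mass (\<kappa> n) (k n) T \<le> 1 / real n"
      using tail_mass_small[of "1 / real n" "\<kappa> n" "k n"] elim(2) by auto
    have "((real (k n))\<^sup>2 / real n) ^ m * min (bessel_ratio (\<kappa> n) ^ (m choose 2)) T \<le> q n ^ m"
      if m: "m \<in> {2..k n}" for m
    proof -
      obtain c where "ln (bessel_ratio (\<kappa> n)) * (real m - 1) / 2 \<le> c" "(real (k n))\<^sup>2 / real n * exp c \<le> q n"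
        using elim(1) m by blast
      then have "((real (k n))\<^sup>2 / real n) ^ m * bessel_ratio (\<kappa> n) ^ (m choose 2) \<le> q n ^ m"
        by (intro overlap_term_le) auto
      then show ?thesis
        by (rule order_trans[rotated]) (intro mult_left_mono min.cobounded1 zero_le_power, simp)
    qed
    then show ?case using T by blast
  qed
qed

section \<open>Communities of smaller or larger than logarithmic order\<close>

text \<open>With \<open>x = n / k^2\<close>, the bound \<open>R \<le> A * sqrt (max 1 \<kappa>)\<close> and the hypothesis on \<open>\<kappa>\<close> give
  \<open>ln R * (m - 1) / 2 \<le> (ln A) * k / 2 + (1 - \<delta> / 4) * ln x\<close> for \<open>m \<le> k\<close>. The first summand is \<open>o(log n)\<close>
  and \<open>ln x\<close> is about \<open>ln n\<close>, so the factor \<open>1 / x\<close> wins by \<open>x powr (- \<delta> / 4)\<close>. Here \<open>\<delta>\<close> is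
  \<open>\<epsilon>\<close> cut down to 1, so that the exponent \<open>4 - \<delta>\<close> is positive.\<close>
lemma impossible_sublogarithmic:
  assumes k: "\<forall>\<^sub>F n in sequentially. k n \<le> n" and \<kappa>: "\<forall>\<^sub>F n in sequentially. 0 < \<kappa> n"
    and lim: "(\<lambda>n. real (k n) / ln (real n)) \<longlonglongrightarrow> 0" and \<epsilon>: "0 < \<epsilon>"
    and ev: "\<forall>\<^sub>F n in sequentially. 2 \<le> k n \<longrightarrow>
         \<kappa> n \<le> (real n / (real (k n))\<^sup>2) powr ((4 - \<epsilon>) / (real (k n) - 1))"
  shows "weak_detection_impossible null_law (\<lambda>n. planted_law n (k n) (\<kappa> n))"
proof -
  obtain A where A: "A \<ge> 1" "\<And>\<kappa>. 0 < \<kappa> \<Longrightarrow> bessel_ratio \<kappa> \<le> A * sqrt (max 1 \<kappa>)"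
    using bessel_ratio_upper by blast
  define \<delta> where "\<delta> = min \<epsilon> 1"
  have \<delta>: "0 < \<delta>" "\<delta> \<le> 1" "\<delta> \<le> \<epsilon>" using \<epsilon> by (auto simp: \<delta>_def)
  define q where "q = (\<lambda>n. exp (\<delta> / 16 * ln (real n) - \<delta> / 4 * (ln (real n) - 2 * ln (ln (real n)))))"
  show ?thesis
  proof (rule impossible_untruncated[OF k, where q = q])
    show "q \<longlonglongrightarrow> 0" unfolding q_def using \<delta>(1) by real_asymp
    show "\<forall>\<^sub>F n in sequentially. 0 \<le> q n" by (simp add: q_def)
    have "(\<lambda>n. ln A / 2 * (real (k n) / ln (real n))) \<longlonglongrightarrow> ln A / 2 * 0"
      by (intro tendsto_intros lim)
    then have "\<forall>\<^sub>F n in sequentially. ln A / 2 * (real (k n) / ln (real n)) < \<delta> / 16"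
      using \<delta> by (intro order_tendstoD) auto
    moreover have "\<forall>\<^sub>F n in sequentially. real (k n) / ln (real n) < 1"
      using lim by (rule order_tendstoD) simp
    moreover have "\<forall>\<^sub>F n in sequentially. 1 < ln (real n)" by real_asymp
    moreover have "\<forall>\<^sub>F n in sequentially. (ln (real n))\<^sup>2 \<le> real n" by real_asymp
    ultimately show "\<forall>\<^sub>F n in sequentially. \<forall>m\<in>{2..k n}. \<exists>c.
      ln (bessel_ratio (\<kappa> n)) * (real m - 1) / 2 \<le> c \<and> (real (k n))\<^sup>2 / real n * exp c \<le> q n"
      using ev \<kappa> eventually_gt_at_top[of 0]
    proof eventually_elim
      case (elim n)
      show ?case
      proof
        fix m assume m: "m \<in> {2..k n}"
        then have k2: "2 \<le> k n" by simp
        define x where "x = real n / (real (k n))\<^sup>2"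
        have ln0: "0 < ln (real n)" using elim by linarith
        have kln: "real (k n) \<le> ln (real n)" using elim(2) ln0 by (simp add: divide_less_eq)
        then have k_sq: "(real (k n))\<^sup>2 \<le> (ln (real n))\<^sup>2" by (intro power_mono) auto
        then have "(real (k n))\<^sup>2 \<le> real n" using elim(4) by (rule order_trans)
        then have x1: "1 \<le> x" unfolding x_def using k2 by (subst le_divide_eq_1_pos) auto
        have lnx: "ln (real n) - 2 * ln (ln (real n)) \<le> ln x"
        proof -
          have "ln (real n) - 2 * ln (ln (real n)) = ln (real n / (ln (real n))\<^sup>2)"
            using elim by (simp add: ln_div ln_realpow)
          also have "\<dots> \<le> ln x"
            unfolding x_def using k_sq k2 ln0 elim
            by (intro ln_mono divide_left_mono divide_pos_pos mult_pos_pos zero_less_power) auto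
          finally show ?thesis .
        qed
        have "\<kappa> n \<le> x powr ((4 - \<epsilon>) / (real (k n) - 1))" using elim k2 by (simp add: x_def)
        also have "\<dots> \<le> x powr ((4 - \<delta>) / (real (k n) - 1))"
          using x1 \<delta> k2 by (intro powr_mono divide_right_mono) auto
        finally have "max 1 (\<kappa> n) \<le> x powr ((4 - \<delta>) / (real (k n) - 1))"
          using x1 \<delta> k2 ge_one_powr_ge_zero[of x "(4 - \<delta>) / (real (k n) - 1)"] by simp
        then have "ln (max 1 (\<kappa> n)) \<le> ln (x powr ((4 - \<delta>) / (real (k n) - 1)))"
          by (intro ln_mono) auto
        also have "\<dots> = (4 - \<delta>) / (real (k n) - 1) * ln x"
          using x1 by (simp add: ln_powr)
        finally have lnmax: "ln (max 1 (\<kappa> n)) \<le> (4 - \<delta>) / (real (k n) - 1) * ln x" .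
        have "ln (bessel_ratio (\<kappa> n)) \<le> ln (A * sqrt (max 1 (\<kappa> n)))"
          using A elim by (intro ln_mono) auto
        also have "\<dots> = ln A + ln (max 1 (\<kappa> n)) / 2"
          using A(1) by (subst ln_mult) (auto simp: ln_sqrt)
        also have "\<dots> \<le> ln A + (4 - \<delta>) / (real (k n) - 1) * ln x / 2"
          by (intro add_left_mono divide_right_mono lnmax) simp
        finally have lnR: "ln (bessel_ratio (\<kappa> n)) \<le> ln A + (4 - \<delta>) / (real (k n) - 1) * ln x / 2" .
        let ?c = "ln A / 2 * real (k n) + (1 - \<delta> / 4) * ln x"
        have "ln (bessel_ratio (\<kappa> n)) * (real m - 1) / 2
            \<le> (ln A + (4 - \<delta>) / (real (k n) - 1) * ln x / 2) * (real m - 1) / 2"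
          using lnR m by (intro divide_right_mono mult_right_mono) auto
        also have "\<dots> = ln A / 2 * (real m - 1) + (1 - \<delta> / 4) * ln x * ((real m - 1) / (real (k n) - 1))"
          using k2 by (simp add: field_simps)
        also have "\<dots> \<le> ln A / 2 * real (k n) + (1 - \<delta> / 4) * ln x * 1"
          using m k2 A(1) \<delta> x1 by (intro add_mono mult_left_mono) auto
        finally have c1: "ln (bessel_ratio (\<kappa> n)) * (real m - 1) / 2 \<le> ?c" by simp
        have "(real (k n))\<^sup>2 / real n = exp (- ln x)"
          using x1 elim k2 by (simp add: exp_minus x_def)
        then have "(real (k n))\<^sup>2 / real n * exp ?c = exp (ln A / 2 * real (k n) - \<delta> / 4 * ln x)"
          by (simp add: exp_add[symmetric] algebra_simps)
        also have "\<dots> \<le> q n"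
        proof -
          have "ln A / 2 * real (k n) \<le> \<delta> / 16 * ln (real n)" using elim(1) ln0 by (simp add: divide_less_eq)
          moreover have "\<delta> / 4 * (ln (real n) - 2 * ln (ln (real n))) \<le> \<delta> / 4 * ln x"
            using lnx \<delta> by (intro mult_left_mono) auto
          ultimately show ?thesis unfolding q_def by simp
        qed
        finally have "(real (k n))\<^sup>2 / real n * exp ?c \<le> q n" .
        with c1 show "\<exists>c. ln (bessel_ratio (\<kappa> n)) * (real m - 1) / 2 \<le> c
            \<and> (real (k n))\<^sup>2 / real n * exp c \<le> q n"
          by (intro exI[of _ ?c] conjI)
      qed
    qed
  qed
qed

text \<open>The bound on \<open>\<kappa>^2\<close> is a multiple of \<open>ln n / (k - 1)\<close>, and \<open>k - 1\<close> is at least \<open>k / 2\<close>.\<close>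
lemma superlogarithmic_kappa_tendsto_0:
  assumes \<kappa>: "\<forall>\<^sub>F n in sequentially. 0 < \<kappa> n"
    and lim: "filterlim (\<lambda>n. real (k n) / ln (real n)) at_top sequentially"
    and ev: "\<forall>\<^sub>F n in sequentially. (\<kappa> n)\<^sup>2 \<le> 4 * p * ln (real n) / (real (k n) - 1)"
  shows "\<kappa> \<longlonglongrightarrow> 0"
proof -
  have inv: "(\<lambda>n. 8 * \<bar>p\<bar> * inverse (real (k n) / ln (real n))) \<longlonglongrightarrow> 8 * \<bar>p\<bar> * 0"
    by (intro tendsto_intros tendsto_inverse_0_at_top lim)
  have "\<forall>\<^sub>F n in sequentially. norm ((\<kappa> n)\<^sup>2) \<le> 8 * \<bar>p\<bar> * inverse (real (k n) / ln (real n))"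
  proof -
    have "\<forall>\<^sub>F n in sequentially. 2 \<le> real (k n) / ln (real n)"
      using lim by (simp add: filterlim_at_top)
    moreover have "\<forall>\<^sub>F n in sequentially. 1 < ln (real n)" by real_asymp
    ultimately show ?thesis using ev
    proof eventually_elim
      case (elim n)
      then have k: "2 \<le> real (k n)" by (simp add: field_simps)
      have "(\<kappa> n)\<^sup>2 \<le> 4 * p * ln (real n) / (real (k n) - 1)" by (rule elim)
      also have "\<dots> \<le> 4 * \<bar>p\<bar> * ln (real n) / (real (k n) - 1)"
        using k elim by (intro divide_right_mono mult_right_mono) auto
      also have "\<dots> \<le> 4 * \<bar>p\<bar> * ln (real n) / (real (k n) / 2)"
        using k elim by (intro divide_left_mono) auto
      finally show ?case by (simp add: field_simps)
    qed
  qed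
  then have "(\<lambda>n. (\<kappa> n)\<^sup>2) \<longlonglongrightarrow> 0"
    by (rule Lim_null_comparison) (use inv in simp)
  then show ?thesis by simp
qed

text \<open>Since \<open>\<kappa>\<close> tends to 0, \<open>ln R\<close> is at most \<open>(1 / 2 + \<epsilon> / 4) * \<kappa>^2\<close>, so with
  \<open>p = 1 - 2 * c - \<epsilon>\<close> the exponent \<open>ln R * (m - 1) / 2\<close> is at most
  \<open>(1 + \<epsilon> / 2) * p * ln n\<close>. As \<open>k^2 / n\<close> is at most \<open>n powr (2 * c - 1)\<close> and \<open>p \<le> 1\<close>,
  a factor of \<open>n powr (- \<epsilon> / 2)\<close> is left.\<close>
lemma impossible_superlogarithmic:
  assumes k: "\<forall>\<^sub>F n in sequentially. k n \<le> n" and \<kappa>: "\<forall>\<^sub>F n in sequentially. 0 < \<kappa> n"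
    and lim: "filterlim (\<lambda>n. real (k n) / ln (real n)) at_top sequentially"
    and c: "0 < c" and \<epsilon>: "0 < \<epsilon>"
    and k_le: "\<forall>\<^sub>F n in sequentially. real (k n) \<le> real n powr c"
    and ev: "\<forall>\<^sub>F n in sequentially. (\<kappa> n)\<^sup>2 \<le> 4 * (1 - 2 * c - \<epsilon>) * ln (real n) / (real (k n) - 1)"
  shows "weak_detection_impossible null_law (\<lambda>n. planted_law n (k n) (\<kappa> n))"
proof (rule impossible_untruncated[OF k, where q = "\<lambda>n. real n powr (- \<epsilon> / 2)"])
  show "(\<lambda>n. real n powr (- \<epsilon> / 2)) \<longlonglongrightarrow> 0" using \<epsilon> by real_asymp
  show "\<forall>\<^sub>F n in sequentially. 0 \<le> real n powr (- \<epsilon> / 2)" by simp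
  obtain \<kappa>\<^sub>0 where \<kappa>\<^sub>0: "0 < \<kappa>\<^sub>0"
    "\<And>\<kappa>. 0 < \<kappa> \<Longrightarrow> \<kappa> < \<kappa>\<^sub>0 \<Longrightarrow> ln (bessel_ratio \<kappa>) \<le> (1 / 2 + \<epsilon> / 4) * \<kappa>\<^sup>2"
    using ln_bessel_ratio_near_0[of "1 / 2 + \<epsilon> / 4"] \<epsilon> by auto
  have "\<forall>\<^sub>F n in sequentially. \<kappa> n < \<kappa>\<^sub>0"
    using superlogarithmic_kappa_tendsto_0[OF \<kappa> lim ev] \<kappa>\<^sub>0(1) by (rule order_tendstoD)
  moreover have "\<forall>\<^sub>F n in sequentially. 1 < ln (real n)" by real_asymp
  ultimately show "\<forall>\<^sub>F n in sequentially. \<forall>m\<in>{2..k n}. \<exists>c.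
      ln (bessel_ratio (\<kappa> n)) * (real m - 1) / 2 \<le> c \<and> (real (k n))\<^sup>2 / real n * exp c \<le> real n powr (- \<epsilon> / 2)"
    using \<kappa> ev k_le eventually_gt_at_top[of 0]
  proof eventually_elim
    case (elim n)
    show ?case
    proof
      fix m assume m: "m \<in> {2..k n}"
      let ?p = "1 - 2 * c - \<epsilon>"
      let ?c = "(1 + \<epsilon> / 2) * ?p * ln (real n)"
      have "ln (bessel_ratio (\<kappa> n)) * (real m - 1) / 2 \<le> ((1 / 2 + \<epsilon> / 4) * (\<kappa> n)\<^sup>2) * (real m - 1) / 2"
        using \<kappa>\<^sub>0(2) elim m by (intro divide_right_mono mult_right_mono) auto
      also have "\<dots> \<le> ((1 / 2 + \<epsilon> / 4) * (\<kappa> n)\<^sup>2) * (real (k n) - 1) / 2"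
        using \<epsilon> m by (intro divide_right_mono mult_left_mono) auto
      also have "\<dots> = (1 / 4 + \<epsilon> / 8) * ((\<kappa> n)\<^sup>2 * (real (k n) - 1))" by (simp add: field_simps)
      also have "\<dots> \<le> (1 / 4 + \<epsilon> / 8) * (4 * ?p * ln (real n))"
        using elim m \<epsilon> by (intro mult_left_mono) (auto simp: field_simps)
      finally have c1: "ln (bessel_ratio (\<kappa> n)) * (real m - 1) / 2 \<le> ?c" by (simp add: field_simps)
      have "(real (k n))\<^sup>2 \<le> (real n powr c)\<^sup>2" using elim by (intro power_mono) auto
      also have "\<dots> = exp (2 * c * ln (real n))"
        using elim by (simp add: powr_def exp_double[symmetric] mult_ac)
      finally have "(real (k n))\<^sup>2 / real n * exp ?c \<le> exp (2 * c * ln (real n)) / real n * exp ?c"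
        by (intro mult_right_mono divide_right_mono) auto
      also have "\<dots> = exp (2 * c * ln (real n)) / exp (ln (real n)) * exp ?c" using elim by simp
      also have "\<dots> = exp ((2 * c - 1 + (1 + \<epsilon> / 2) * ?p) * ln (real n))"
        unfolding exp_add[symmetric] exp_diff[symmetric] by (simp add: algebra_simps)
      also have "\<dots> \<le> exp (- \<epsilon> / 2 * ln (real n))"
      proof -
        have "\<epsilon> / 2 * ?p \<le> \<epsilon> / 2 * 1" using c \<epsilon> by (intro mult_left_mono) auto
        then have "2 * c - 1 + (1 + \<epsilon> / 2) * ?p \<le> - \<epsilon> / 2" by (simp add: algebra_simps)
        then show ?thesis using elim by (subst exp_le_cancel_iff) (intro mult_right_mono, auto)
      qed
      also have "\<dots> = real n powr (- \<epsilon> / 2)" using elim by (simp add: powr_def)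
      finally have "(real (k n))\<^sup>2 / real n * exp ?c \<le> real n powr (- \<epsilon> / 2)" .
      with c1 show "\<exists>c. ln (bessel_ratio (\<kappa> n)) * (real m - 1) / 2 \<le> c \<and>
          (real (k n))\<^sup>2 / real n * exp c \<le> real n powr (- \<epsilon> / 2)"
        by (intro exI[of _ ?c] conjI)
    qed
  qed
qed

section \<open>Communities of exactly logarithmic order\<close>

text \<open>With \<open>D_a\<close> the Renyi divergence of order \<open>a\<close> of the von Mises law from the uniform law, this is
  \<open>D_2 - D_(3/2)\<close>: the amount by which \<open>ln R = D_2\<close> exceeds twice the logarithm of the moment
  of order 3/2 of the density ratio.\<close>
definition renyi_gap :: "real \<Rightarrow> real" where
  "renyi_gap \<kappa> = ln (bessel_I0 \<kappa>) + ln (bessel_I0 (2 * \<kappa>)) - 2 * ln (bessel_I0 (3 / 2 * \<kappa>))"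

lemma renyi_gap_pos:
  assumes "\<kappa> \<noteq> 0"
  shows "0 < renyi_gap \<kappa>"
proof -
  have "ln ((bessel_I0 (3 / 2 * \<kappa>))\<^sup>2) < ln (bessel_I0 \<kappa> * bessel_I0 (2 * \<kappa>))"
    using bessel_I0_strict_log_convex[OF assms]
    by (subst ln_less_cancel_iff) (auto intro!: zero_less_power mult_pos_pos)
  then show ?thesis
    unfolding renyi_gap_def by (subst (asm) ln_mult) (auto simp: ln_realpow)
qed

lemma renyi_gap_bounded_below:
  assumes "0 < a" "a \<le> b"
  shows "\<exists>r>0. \<forall>\<kappa>\<in>{a..b}. r \<le> renyi_gap \<kappa>"
proof -
  have c: "continuous_on {a..b} (\<lambda>\<kappa>. ln (bessel_I0 (c * \<kappa>)))" for c
    by (intro continuous_on_ln continuous_on_compose2[OF continuous_on_bessel_I0[of UNIV]] continuous_intros) auto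
  have "continuous_on {a..b} renyi_gap"
    unfolding renyi_gap_def [abs_def] 
    by (intro continuous_on_diff continuous_on_add continuous_on_mult continuous_on_const
        c c[of 1, simplified])
  then obtain \<kappa> where "\<kappa> \<in> {a..b}" "\<forall>y\<in>{a..b}. renyi_gap \<kappa> \<le> renyi_gap y"
    using continuous_attains_inf[of "{a..b}" renyi_gap] assms by auto
  then show ?thesis using renyi_gap_pos[of \<kappa>] assms by (intro exI[of _ "renyi_gap \<kappa>"]) auto
qed

text \<open>The threshold \<open>exp (N * (ln R - r / 2))\<close>, \<open>N\<close> the number of edges, gives up half of the gap to stay
  below \<open>R ^ N\<close>; the other half makes the tail mass decay.\<close>
lemma tail_mass_le:
  assumes r: "r \<le> renyi_gap \<kappa>" and T: "exp (real (k choose 2) * (ln (bessel_ratio \<kappa>) - r / 2)) \<le> T"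
  shows "tail_mass \<kappa> k T \<le> exp (- (real (k choose 2) * r / 4))"
proof -
  let ?N = "real (k choose 2)"
  let ?b = "bessel_I0 (3 / 2 * \<kappa>) / bessel_I0 \<kappa> powr (3 / 2)"
  let ?t = "ln (bessel_ratio \<kappa>) - r / 2"
  have b: "0 < ?b" by (intro divide_pos_pos) auto
  have lnb: "ln ?b = ln (bessel_I0 (3 / 2 * \<kappa>)) - 3 / 2 * ln (bessel_I0 \<kappa>)"
    by (subst ln_div) (auto simp: ln_powr)
  have "ln ?b - ?t / 2 = - (renyi_gap \<kappa> / 2) + r / 4"
    unfolding lnb renyi_gap_def ln_bessel_ratio by (simp add: field_simps)
  then have e: "ln ?b - ?t / 2 \<le> - (r / 4)" using r by linarith
  have "exp (?N * ?t / 2) = sqrt (exp (?N * ?t))"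
    by (rule real_sqrt_unique[symmetric]) (simp_all add: exp_double[symmetric])
  also have "\<dots> \<le> sqrt T" using T by simp
  finally have "?b ^ (k choose 2) / sqrt T \<le> ?b ^ (k choose 2) / exp (?N * ?t / 2)"
    using less_le_trans[OF exp_gt_zero T]
    by (intro divide_left_mono mult_pos_pos zero_le_power less_imp_le[OF b]) auto
  also have "\<dots> = exp (?N * ln ?b) / exp (?N * ?t / 2)"
    using b by (simp add: exp_of_nat_mult)
  also have "\<dots> = exp (?N * (ln ?b - ?t / 2))"
    unfolding exp_diff[symmetric] by (simp add: algebra_simps)
  also have "\<dots> \<le> exp (?N * (- (r / 4)))"
    using e by (subst exp_le_cancel_iff, intro mult_left_mono) auto
  finally show ?thesis unfolding tail_mass_def by simp
qed

text \<open>If \<open>m\<close> is at most \<open>(1 - b / 2) * k\<close>, the first term does it. Otherwise the second does, because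
  \<open>1 - b \<le> (1 - b / 2)^2\<close>. Thus the minimum is bounded linearly in \<open>m\<close>, as needed for a geometric bound, with
  slope \<open>(1 - b / 2) * k\<close> instead of \<open>k\<close>.\<close>
lemma min_exponent_le:
  fixes m k b :: real
  assumes m: "0 \<le> m" "m \<le> k" and b: "0 \<le> b" "b \<le> 1"
  shows "min (m * m) (k * k * (1 - b)) \<le> m * (k * (1 - b / 2))"
proof (cases "m \<le> k * (1 - b / 2)")
  case True
  then have "m * m \<le> m * (k * (1 - b / 2))" using m by (intro mult_left_mono) auto
  then show ?thesis by simp
next
  case False
  have "k * k * (1 - b) \<le> k * k * (1 - b / 2)\<^sup>2"
    using m by (intro mult_left_mono) (auto simp: power2_eq_square algebra_simps)
  also have "\<dots> = (k * (1 - b / 2)) * (k * (1 - b / 2))" by (simp add: power2_eq_square)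
  also have "\<dots> \<le> m * (k * (1 - b / 2))" using False m b by (intro mult_right_mono) auto
  finally show ?thesis by simp
qed

text \<open>For \<open>\<kappa> < a\<close> the second moment itself is fine, as \<open>c * ln R\<close> is at most 1 instead of just below 2.
  The remaining \<open>\<kappa>\<close> lie in a compact interval \<open>{a..b}\<close>, because \<open>R\<close> grows like \<open>sqrt \<kappa>\<close> and is
  bounded by \<open>exp (2 / c)\<close>; there \<open>renyi_gap\<close> is at least some \<open>r > 0\<close>. Truncating at
  \<open>exp (N * (ln R - r / 2))\<close> with \<open>N = k choose 2\<close>, the overlap terms are at most
  \<open>((k^2 / n) * exp (k * (1 - \<beta> / 2) / c)) ^ m\<close>, where \<open>k / c \<sim> ln n\<close>.\<close>
lemma impossible_logarithmic:
  assumes k: "\<forall>\<^sub>F n in sequentially. k n \<le> n" and \<kappa>: "\<forall>\<^sub>F n in sequentially. 0 < \<kappa> n"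
    and c: "0 < c" and lim: "(\<lambda>n. real (k n) / ln (real n)) \<longlonglongrightarrow> c"
    and ev: "\<forall>\<^sub>F n in sequentially. c * ln (bessel_ratio (\<kappa> n)) < 2"
  shows "weak_detection_impossible null_law (\<lambda>n. planted_law n (k n) (\<kappa> n))"
proof -
  obtain \<kappa>\<^sub>1 where \<kappa>\<^sub>1: "0 < \<kappa>\<^sub>1" "\<And>\<kappa>. 0 < \<kappa> \<Longrightarrow> \<kappa> < \<kappa>\<^sub>1 \<Longrightarrow> ln (bessel_ratio \<kappa>) \<le> 1 * \<kappa>\<^sup>2"
    using ln_bessel_ratio_near_0[of 1] by auto
  define a where "a = min (\<kappa>\<^sub>1 / 2) (1 / sqrt c)"
  have a: "0 < a" using \<kappa>\<^sub>1 c by (simp add: a_def)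
  have small: "c * ln (bessel_ratio \<kappa>) \<le> 1" if "0 < \<kappa>" "\<kappa> < a" for \<kappa>
  proof -
    have "ln (bessel_ratio \<kappa>) \<le> \<kappa>\<^sup>2" using \<kappa>\<^sub>1 that by (simp add: a_def)
    also have "\<dots> \<le> (1 / sqrt c)\<^sup>2" using that by (intro power_mono) (auto simp: a_def)
    also have "\<dots> = 1 / c" using c by (simp add: power_divide)
    finally show ?thesis using c by (simp add: field_simps)
  qed
  \<comment> \<open>Solves \<open>sqrt b / 160 = exp (2 / c)\<close>, with the constant of \<open>bessel_ratio_lower\<close>.\<close>
  define b where "b = max (max 1 a) ((160 * exp (2 / c))\<^sup>2)"
  have large: "\<kappa> \<le> b" if "0 < \<kappa>" "c * ln (bessel_ratio \<kappa>) < 2" for \<kappa>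
  proof (cases "\<kappa> \<le> 1")
    case False
    then have "sqrt \<kappa> / 160 \<le> bessel_ratio \<kappa>" by (intro bessel_ratio_lower) simp
    also have "\<dots> \<le> exp (2 / c)"
    proof -
      have "ln (bessel_ratio \<kappa>) \<le> 2 / c" using that c by (simp add: field_simps)
      then show ?thesis using exp_le_cancel_iff[of "ln (bessel_ratio \<kappa>)" "2 / c"] by simp
    qed
    finally have "sqrt \<kappa> \<le> 160 * exp (2 / c)" by simp
    then have "(sqrt \<kappa>)\<^sup>2 \<le> (160 * exp (2 / c))\<^sup>2" using that by (intro power_mono) auto
    then show ?thesis using that by (simp add: b_def)
  qed (simp add: b_def)
  obtain r where r: "0 < r" "\<And>\<kappa>. \<kappa> \<in> {a..b} \<Longrightarrow> r \<le> renyi_gap \<kappa>"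
  proof -
    have "a \<le> b" by (simp add: b_def)
    then show ?thesis using renyi_gap_bounded_below[OF a] that by blast
  qed
  \<comment> \<open>The relative amount by which the threshold stays below the critical exponent:
    \<open>c * (ln R - r / 2) < 2 - c * r / 2 \<le> 2 * (1 - \<beta>)\<close>.\<close>
  define \<beta> where "\<beta> = min (c * r / 4) 1"
  have \<beta>: "0 < \<beta>" "\<beta> \<le> 1" "\<beta> \<le> c * r / 4" using r c by (auto simp: \<beta>_def)
  define q where "q = (\<lambda>n. 4 * c\<^sup>2 * (ln (real n))\<^sup>2 * real n powr (- \<beta> / 4))"
  define h where "h = (\<lambda>n. exp (- (real (k n) * r / 8)) + 1 / real n)"
  have k_inf: "filterlim (\<lambda>n. real (k n)) at_top sequentially"
  proof -
    have "filterlim (\<lambda>n. (real (k n) / ln (real n)) * ln (real n)) at_top sequentially"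
      by (rule filterlim_tendsto_pos_mult_at_top[OF lim c]) real_asymp
    then show ?thesis
      by (rule filterlim_cong[THEN iffD1, rotated 3, OF _ refl refl])
         (use eventually_gt_at_top[of 1] in \<open>eventually_elim, simp\<close>)
  qed
  show ?thesis
  proof (rule impossible_from_moments[OF k, where q = q and h = h])
    show "q \<longlonglongrightarrow> 0" unfolding q_def using \<beta>(1) c by real_asymp
    show "\<forall>\<^sub>F n in sequentially. 0 \<le> q n" by (simp add: q_def)
    have "filterlim (\<lambda>n. r / 8 * real (k n)) at_top sequentially"
      by (rule filterlim_tendsto_pos_mult_at_top[OF tendsto_const _ k_inf]) (use r in simp)
    then have "filterlim (\<lambda>n. - (real (k n) * r / 8)) at_bot sequentially"
      unfolding filterlim_uminus_at_top by (simp add: mult.commute)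
    then have "(\<lambda>n. exp (- (real (k n) * r / 8))) \<longlonglongrightarrow> 0"
      by (rule filterlim_compose[OF exp_at_bot])
    moreover have "(\<lambda>n. 1 / real n) \<longlonglongrightarrow> 0" by real_asymp
    ultimately show "h \<longlonglongrightarrow> 0" unfolding h_def using tendsto_add_zero by blast
    have "(\<lambda>n. real (k n) / ln (real n) * ((1 - \<beta> / 2) / c)) \<longlonglongrightarrow> c * ((1 - \<beta> / 2) / c)"
      by (intro tendsto_intros lim)
    then have "\<forall>\<^sub>F n in sequentially. real (k n) / ln (real n) * ((1 - \<beta> / 2) / c) < 1 - \<beta> / 4"
      by (rule order_tendstoD) (use \<beta> c in simp)
    moreover have "\<forall>\<^sub>F n in sequentially. real (k n) / ln (real n) < 2 * c"
      using lim by (rule order_tendstoD) (use c in simp)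
    moreover have "\<forall>\<^sub>F n in sequentially. 1 < ln (real n)" by real_asymp
    moreover have "\<forall>\<^sub>F n in sequentially. 2 \<le> real (k n)"
      using k_inf unfolding filterlim_at_top by blast
    ultimately show "\<forall>\<^sub>F n in sequentially. \<exists>T>0. tail_mass (\<kappa> n) (k n) T \<le> h n \<and>
      (\<forall>m\<in>{2..k n}. ((real (k n))\<^sup>2 / real n) ^ m * min (bessel_ratio (\<kappa> n) ^ (m choose 2)) T \<le> q n ^ m)"
      using ev \<kappa> eventually_gt_at_top[of 0]
    proof eventually_elim
      case (elim n)
      define K where "K = real (k n)"
      define R where "R = bessel_ratio (\<kappa> n)"
      define e where "e = K * (1 - \<beta> / 2) / c"
      have K: "2 \<le> K" using elim by (simp add: K_def)
      have R: "0 < R" "c * ln R < 2" using elim by (auto simp: R_def)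
      have ln0: "0 < ln (real n)" using elim(3) by linarith
      have q: "K\<^sup>2 / real n * exp e \<le> q n"
      proof -
        have "K \<le> 2 * c * ln (real n)" using elim(2) ln0 by (simp add: K_def divide_less_eq)
        then have "K\<^sup>2 \<le> (2 * c * ln (real n))\<^sup>2" using K by (intro power_mono) auto
        moreover have "e \<le> (1 - \<beta> / 4) * ln (real n)"
        proof -
          have "e = real (k n) / ln (real n) * ((1 - \<beta> / 2) / c) * ln (real n)"
            using ln0 by (simp add: e_def K_def)
          also have "\<dots> \<le> (1 - \<beta> / 4) * ln (real n)"
            using elim(1) ln0 by (intro mult_right_mono) auto
          finally show ?thesis .
        qed
        ultimately have "K\<^sup>2 / real n * exp e \<le> (2 * c * ln (real n))\<^sup>2 / real n * exp ((1 - \<beta> / 4) * ln (real n))"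
          by (intro mult_mono divide_right_mono) auto
        also have "\<dots> = (2 * c * ln (real n))\<^sup>2 / exp (ln (real n)) * exp ((1 - \<beta> / 4) * ln (real n))"
          using elim by simp
        also have "\<dots> = (2 * c * ln (real n))\<^sup>2 * (exp ((1 - \<beta> / 4) * ln (real n)) / exp (ln (real n)))"
          by simp
        also have "\<dots> = (2 * c * ln (real n))\<^sup>2 * exp (- \<beta> / 4 * ln (real n))"
          unfolding exp_diff[symmetric] by (simp add: algebra_simps)
        also have "\<dots> = q n"
          using elim by (simp add: q_def powr_def power_mult_distrib)
        finally show ?thesis .
      qed
      have term_le: "(K\<^sup>2 / real n) ^ m * X \<le> q n ^ m" if "X \<le> exp (real m * e)" for m X
      proof -
        have "(K\<^sup>2 / real n) ^ m * X \<le> (K\<^sup>2 / real n) ^ m * exp (real m * e)"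
          using that by (intro mult_left_mono) auto
        also have "\<dots> = (K\<^sup>2 / real n * exp e) ^ m" by (simp only: power_mult_distrib exp_of_nat_mult)
        also have "\<dots> \<le> q n ^ m" using q by (intro power_mono) auto
        finally show ?thesis .
      qed
      show ?case
      proof (cases "\<kappa> n < a")
        case True
        obtain T where T: "0 < T" "tail_mass (\<kappa> n) (k n) T \<le> 1 / real n"
          using tail_mass_small[of "1 / real n" "\<kappa> n" "k n"] elim by auto
        have "(K\<^sup>2 / real n) ^ m * min (R ^ (m choose 2)) T \<le> q n ^ m" if m: "m \<in> {2..k n}" for m
        proof (rule term_le)
          have "c * ln R \<le> 1" using small[of "\<kappa> n"] True elim by (simp add: R_def)
          then have "ln R \<le> 1 / c" using c by (simp add: field_simps)
          then have "ln R * (real m * (real m - 1) / 2) \<le> 1 / c * (real m * (real m - 1) / 2)"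
            using m by (intro mult_right_mono) auto
          also have "\<dots> \<le> 1 / c * (real m * K / 2)"
            using m c by (intro mult_left_mono divide_right_mono) (auto simp: K_def)
          also have "\<dots> = real m * (K * (1 / 2) / c)" by simp
          also have "\<dots> \<le> real m * e"
            unfolding e_def using \<beta> K c by (intro mult_left_mono divide_right_mono) auto
          finally have "R ^ (m choose 2) \<le> exp (real m * e)"
            unfolding power_choose_two[OF R(1)] by simp
          then show "min (R ^ (m choose 2)) T \<le> exp (real m * e)" by simp
        qed
        moreover have "tail_mass (\<kappa> n) (k n) T \<le> h n"
          using T(2) unfolding h_def by (smt (verit) exp_gt_zero)
        ultimately show ?thesis using T(1) unfolding K_def R_def by blast
      next
        case False
        then have "\<kappa> n \<in> {a..b}" using large[of "\<kappa> n"] elim by auto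
        then have gap: "r \<le> renyi_gap (\<kappa> n)" by (rule r(2))
        define T where "T = exp (real (k n choose 2) * (ln R - r / 2))"
        have "tail_mass (\<kappa> n) (k n) T \<le> exp (- (real (k n choose 2) * r / 4))"
          by (rule tail_mass_le[OF gap]) (simp add: T_def R_def)
        also have "\<dots> \<le> exp (- (K * r / 8))"
        proof -
          have "K * 1 \<le> K * (K - 1)" using K by (intro mult_left_mono) auto
          then have "K / 2 \<le> real (k n choose 2)" by (simp add: real_choose_two K_def)
          then have "K / 2 * r \<le> real (k n choose 2) * r" using r by (intro mult_right_mono) auto
          then show ?thesis by simp
        qed
        also have "\<dots> \<le> h n" by (simp add: h_def K_def)
        finally have tail: "tail_mass (\<kappa> n) (k n) T \<le> h n" .
        have T_le: "T \<le> exp (K * K * (1 - \<beta>) / c)"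
        proof -
          have "c * (ln R - r / 2) \<le> 2 * (1 - \<beta>)" using R(2) \<beta>(3) by (simp add: algebra_simps)
          then have "ln R - r / 2 \<le> 2 * (1 - \<beta>) / c" using c by (simp add: field_simps)
          then have "real (k n choose 2) * (ln R - r / 2) \<le> real (k n choose 2) * (2 * (1 - \<beta>) / c)"
            by (intro mult_left_mono) auto
          also have "\<dots> = K * (K - 1) * ((1 - \<beta>) / c)"
          proof -
            have "x / 2 * (2 * y / c) = x * (y / c)" for x y :: real by simp
            then show ?thesis unfolding real_choose_two K_def .
          qed
          also have "\<dots> \<le> K * K * ((1 - \<beta>) / c)"
            using K \<beta> c by (intro mult_right_mono mult_left_mono) auto
          finally show ?thesis by (simp add: T_def)
        qed
        have "(K\<^sup>2 / real n) ^ m * min (R ^ (m choose 2)) T \<le> q n ^ m" if m: "m \<in> {2..k n}" for m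
        proof (rule term_le)
          have "ln R \<le> 2 / c" using R c by (simp add: field_simps)
          then have "ln R * (real m * (real m - 1) / 2) \<le> 2 / c * (real m * (real m - 1) / 2)"
            using m by (intro mult_right_mono) auto
          also have "\<dots> \<le> 2 / c * (real m * real m / 2)"
            using m c by (intro mult_left_mono divide_right_mono) auto
          finally have "R ^ (m choose 2) \<le> exp (real m * real m / c)"
            unfolding power_choose_two[OF R(1)] by simp
          then have "min (R ^ (m choose 2)) T \<le> min (exp (real m * real m / c)) (exp (K * K * (1 - \<beta>) / c))"
            using T_le by (intro min.mono)
          also have "\<dots> = exp (min (real m * real m) (K * K * (1 - \<beta>)) / c)"
            using c by (auto simp: min_def divide_le_cancel)
          also have "\<dots> \<le> exp (real m * (K * (1 - \<beta> / 2)) / c)"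
            using min_exponent_le[of "real m" K \<beta>] m \<beta> c
            by (subst exp_le_cancel_iff, intro divide_right_mono) (auto simp: K_def)
          also have "\<dots> = exp (real m * e)" by (simp add: e_def)
          finally show "min (R ^ (m choose 2)) T \<le> exp (real m * e)" .
        qed
        then show ?thesis using tail unfolding K_def R_def
          by (intro exI[of _ T]) (auto simp: T_def)
      qed
    qed
  qed
qed

section \<open>Impossibility of weak detection in the three regimes\<close>

theorem corollary8:
  fixes k :: "nat \<Rightarrow> nat" and \<kappa> :: "nat \<Rightarrow> real"
  assumes "\<forall>\<^sub>F n in sequentially. k n \<le> n"
    and "\<forall>\<^sub>F n in sequentially. 0 < \<kappa> n"
  shows
    "((\<lambda>n. real (k n) / ln (real n)) \<longlonglongrightarrow> 0 \<and>
      (\<exists>\<epsilon>>0. \<forall>\<^sub>F n in sequentially. 2 \<le> k n \<longrightarrow>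
         \<kappa> n \<le> (real n / (real (k n))\<^sup>2) powr ((4 - \<epsilon>) / (real (k n) - 1)))
      \<longrightarrow> weak_detection_impossible null_law (\<lambda>n. planted_law n (k n) (\<kappa> n)))
     \<and>
     ((\<exists>c>0. (\<lambda>n. real (k n) / ln (real n)) \<longlonglongrightarrow> c \<and>
         (\<forall>\<^sub>F n in sequentially. c * ln (bessel_ratio (\<kappa> n)) < 2))
      \<longrightarrow> weak_detection_impossible null_law (\<lambda>n. planted_law n (k n) (\<kappa> n)))
     \<and>
     (filterlim (\<lambda>n. real (k n) / ln (real n)) at_top sequentially \<and>
      (\<exists>c \<epsilon>. 0 < c \<and> c < 1 / 2 \<and> 0 < \<epsilon> \<and>
         (\<forall>\<^sub>F n in sequentially. real (k n) \<le> real n powr c) \<and>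
         (\<forall>\<^sub>F n in sequentially.
            (\<kappa> n)\<^sup>2 \<le> 4 * (1 - 2 * c - \<epsilon>) * ln (real n) / (real (k n) - 1)))
      \<longrightarrow> weak_detection_impossible null_law (\<lambda>n. planted_law n (k n) (\<kappa> n)) \<and> \<kappa> \<longlonglongrightarrow> 0)"
proof (intro conjI impI)
  assume "(\<lambda>n. real (k n) / ln (real n)) \<longlonglongrightarrow> 0 \<and>
      (\<exists>\<epsilon>>0. \<forall>\<^sub>F n in sequentially. 2 \<le> k n \<longrightarrow>
         \<kappa> n \<le> (real n / (real (k n))\<^sup>2) powr ((4 - \<epsilon>) / (real (k n) - 1)))"
  then show "weak_detection_impossible null_law (\<lambda>n. planted_law n (k n) (\<kappa> n))"
    using impossible_sublogarithmic[OF assms] by blast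
next
  assume "\<exists>c>0. (\<lambda>n. real (k n) / ln (real n)) \<longlonglongrightarrow> c \<and>
         (\<forall>\<^sub>F n in sequentially. c * ln (bessel_ratio (\<kappa> n)) < 2)"
  then show "weak_detection_impossible null_law (\<lambda>n. planted_law n (k n) (\<kappa> n))"
    using impossible_logarithmic[OF assms] by blast
next
  assume *: "filterlim (\<lambda>n. real (k n) / ln (real n)) at_top sequentially \<and>
      (\<exists>c \<epsilon>. 0 < c \<and> c < 1 / 2 \<and> 0 < \<epsilon> \<and>
         (\<forall>\<^sub>F n in sequentially. real (k n) \<le> real n powr c) \<and>
         (\<forall>\<^sub>F n in sequentially.
            (\<kappa> n)\<^sup>2 \<le> 4 * (1 - 2 * c - \<epsilon>) * ln (real n) / (real (k n) - 1)))"
  then show "weak_detection_impossible null_law (\<lambda>n. planted_law n (k n) (\<kappa> n))"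
    using impossible_superlogarithmic[OF assms] by blast
  from * show "\<kappa> \<longlonglongrightarrow> 0"
    using superlogarithmic_kappa_tendsto_0[OF assms(2)] by blast
qed

end
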